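(* Let a resource-layer model be given as in the context, with link outcomes of different activation slots independent, every aggregation window starting empty with the announced demand fixed throughout the window, and the class of admissible strategies closed under concatenation. For fixed $N$, $M$, $F_\star$, write $C_{\mathrm{ET}}^{(W)}=C_{\mathrm{ET}}^{(W)}(N,M;F_\star)$. Then the limit $C_{\mathrm{ET}}^{(\infty)}:=\lim_{W\to\infty}C_{\mathrm{ET}}^{(W)}$ exists, and $$C_{\mathrm{ET}}^{(\infty)}=\sup_{W\ge1}C_{\mathrm{ET}}^{(W)},\qquad C_{\mathrm{ET}}^{(1)}\le C_{\mathrm{ET}}^{(W)}\le C_{\mathrm{ET}}^{(\infty)}\quad\text{for every finite } W\ge1 .$$
   Context: Resource-layer model. A finite multigraph $G=(V,E)$ without self-loops, $|V|=N$, whose edges are link opportunities. In every activation slot each $e\in E$ is attempted once and succeeds with probability $p_e$; each success supplies one elementary entangled pair in a declared state to its endpoints. Slots are independent and identically distributed. A random demand $\mathcal D=\{(s_i,t_i)\}$ of sessions between $M$ active users (an $M$-subset of $V$ chosen uniformly and paired uniformly at random) is sampled once per window, announced before the first slot, and held fixed. $d(s_i,t_i)\ge0$ is the physical distance between endpoints. An aggregation window of $W$ consecutive slots starts empty. A $W$-slot admissible strategy is an adaptive LOCC protocol (from a declared class specifying permitted operations and the heralded link information on which they may depend) acting on the pairs supplied in the window with ideal storage. $B_i^{(W)}$ is the number of two-qubit outputs delivered for session $i$ in the window whose fidelity with $|\Phi^+\rangle=(|00\rangle+|11\rangle)/\sqrt2$ (conditioned on realized links and the classical delivery record) is at least $F_\star$.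 The capacity is $$C_{\mathrm{ET}}^{(W)}=\sup_{\text{admissible}}\frac1W\,\mathbb E\Big[\sum_id(s_i,t_i)B_i^{(W)}\Big].$$ Closure under concatenation: for any $k$-slot and $\ell$-slot admissible strategies, running the first on slots $1,\dots,k$ and the second on slots $k+1,\dots,k+\ell$ (same demand, unused resources discarded at the boundary) is an admissible $(k+\ell)$-slot strategy, whose output counts are the sums of the two. *)

theory Defs
  imports
    "HOL-Analysis.Analysis"
    "HOL-Probability.Probability"
    "HOL-Library.Groups_Big_Fun"
begin

section \<open>Networks and demands\<close>

text \<open>
  Edges are named, so parallel edges are distinct elements of \<open>edges\<close> with equal \<open>ends\<close>.
  \<open>slot_law\<close> is the law of the set of edges that succeed in one slot; only its one-edge
  marginals are prescribed (by \<open>success\<close>), edges need not be independent within a slot.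
  \<open>pair_state e\<close> is the density matrix of the elementary pair supplied by \<open>e\<close>, whose two
  qubits are named by the endpoints of \<open>e\<close>.  Here and
  below the computational basis of a qubit register \<open>Q\<close> is indexed by the subsets of \<open>Q\<close>:
  \<open>A\<close> stands for the basis vector in which exactly the qubits in \<open>A\<close> are 1.
\<close>

type_synonym 'q matrix = "'q set \<Rightarrow> 'q set \<Rightarrow> complex"

record ('v, 'e) network =
  nodes :: "'v set"
  edges :: "'e set"
  ends :: "'e \<Rightarrow> 'v set"
  success :: "'e \<Rightarrow> real"
  slot_law :: "'e set pmf"
  pair_state :: "'e \<Rightarrow> 'v matrix"
  distance :: "'v \<Rightarrow> 'v \<Rightarrow> real"

definition density_matrix :: "'q set \<Rightarrow> 'q matrix \<Rightarrow> bool" where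
  "density_matrix Q \<rho> \<longleftrightarrow>
     (\<forall>x. let q = (\<Sum>A\<in>Pow Q. \<Sum>B\<in>Pow Q. cnj (x A) * \<rho> A B * x B) in Im q = 0 \<and> 0 \<le> Re q) \<and>
     (\<Sum>A\<in>Pow Q. \<rho> A A) = 1"

definition resource_network :: "('v, 'e) network \<Rightarrow> bool" where
  "resource_network G \<longleftrightarrow>
     finite (nodes G) \<and> finite (edges G) \<and>
     (\<forall>e\<in>edges G. ends G e \<subseteq> nodes G \<and> card (ends G e) = 2) \<and>
     set_pmf (slot_law G) \<subseteq> Pow (edges G) \<and>
     (\<forall>e\<in>edges G. measure_pmf.prob (slot_law G) {A. e \<in> A} = success G e) \<and>
     (\<forall>e\<in>edges G. density_matrix (ends G e) (pair_state G e)) \<and>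
     (\<forall>s\<in>nodes G. \<forall>t\<in>nodes G. 0 \<le> distance G s t)"

type_synonym 'v demand = "('v \<times> 'v) set"

definition pairings :: "'v set \<Rightarrow> 'v demand set" where
  "pairings U =
     {D. D \<subseteq> U \<times> U \<and> (\<forall>(s, t)\<in>D. s \<noteq> t) \<and> (\<forall>u\<in>U. \<exists>!i. i \<in> D \<and> (u = fst i \<or> u = snd i))}"

definition demand_law :: "('v, 'e) network \<Rightarrow> nat \<Rightarrow> 'v demand pmf" where
  "demand_law G M =
     bind_pmf (pmf_of_set {U. U \<subseteq> nodes G \<and> card U = M}) (\<lambda>U. pmf_of_set (pairings U))"

text \<open>
  The link record of a \<open>W\<close>-slot window lists, slot by slot, the edges that succeeded.
\<close>

definition links_law :: "('v, 'e) network \<Rightarrow> nat \<Rightarrow> 'e set list pmf" where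
  "links_law G W = replicate_pmf W (slot_law G)"


section \<open>Qubits and states of a window\<close>

text \<open>
  \<open>Half w e v\<close> is the qubit at endpoint \<open>v\<close> of the pair supplied by edge \<open>e\<close> in slot \<open>w\<close>
  (slots are counted from 0); \<open>Memory w v n\<close> is a workspace qubit that \<open>v\<close> prepares in state 0
  in slot \<open>w\<close>.  A matrix over all qubits with finite support describes a state in which all but
  finitely many qubits are 0, so every node has unlimited ancillas.
\<close>

datatype ('v, 'e) qubit =
    Half (slot: nat) (edge: 'e) (holder: 'v)
  | Memory (slot: nat) (holder: 'v) (cell: nat)

definition register :: "('v, 'e) network \<Rightarrow> 'e set list \<Rightarrow> 'v \<Rightarrow> ('v, 'e) qubit set" where
  "register G \<omega> v =
     {Half w e v | w e. w < length \<omega> \<and> e \<in> \<omega> ! w \<and> v \<in> ends G e} \<union>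
     {Memory w v n | w n. w < length \<omega>}"

definition supplied :: "('v, 'e) network \<Rightarrow> 'e set list \<Rightarrow> ('v, 'e) qubit set" where
  "supplied G \<omega> = {Half w e v | w e v. w < length \<omega> \<and> e \<in> \<omega> ! w \<and> v \<in> ends G e}"

definition supplied_state :: "('v, 'e) network \<Rightarrow> 'e set list \<Rightarrow> ('v, 'e) qubit matrix" where
  "supplied_state G \<omega> A B =
     (if A \<subseteq> supplied G \<omega> \<and> B \<subseteq> supplied G \<omega>
      then \<Prod>w<length \<omega>. \<Prod>e\<in>\<omega> ! w. pair_state G e {v. Half w e v \<in> A} {v. Half w e v \<in> B}
      else 0)"

text \<open>\<open>Sum_any\<close> sums a function over its (finite) support.\<close>

definition mtrace :: "'q matrix \<Rightarrow> complex" where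
  "mtrace \<rho> = Sum_any (\<lambda>A. \<rho> A A)"

definition reduced_state :: "'q set \<Rightarrow> 'q matrix \<Rightarrow> 'q matrix" where
  "reduced_state Q \<rho> A B = Sum_any (\<lambda>C. if C \<inter> Q = {} then \<rho> (A \<union> C) (B \<union> C) else 0)"

definition bell_vector :: "'q \<Rightarrow> 'q \<Rightarrow> 'q set \<Rightarrow> complex" where
  "bell_vector a b A = (if A = {} \<or> A = {a, b} then of_real (1 / sqrt 2) else 0)"

definition bell_fidelity :: "'q matrix \<Rightarrow> 'q \<Rightarrow> 'q \<Rightarrow> real" where
  "bell_fidelity \<rho> a b =
     Re (\<Sum>A\<in>Pow {a, b}. \<Sum>B\<in>Pow {a, b}.
       cnj (bell_vector a b A) * reduced_state {a, b} \<rho> A B * bell_vector a b B)"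


section \<open>LOCC protocols\<close>

text \<open>
  An output for session \<open>i = (s, t)\<close> consists of a qubit at \<open>s\<close>, a qubit at \<open>t\<close> and a classical
  label that may carry any heralding information.  A protocol is a finite tree: in
  \<open>Local v X Ks next\<close>, node \<open>v\<close> performs on the qubits \<open>X\<close> the instrument with Kraus operators
  \<open>Ks\<close>, and the index of the outcome is announced and selects the continuation.  Different
  branches may end with the same delivery record, so an outcome need not be remembered.
\<close>

datatype ('v, 'e) bell_output =
  Output (session: "'v \<times> 'v") (qubit1: "('v, 'e) qubit") (qubit2: "('v, 'e) qubit") (label: nat)

type_synonym ('v, 'e) delivery = "('v, 'e) bell_output list"

datatype ('v, 'e) protocol =
    Halt "('v, 'e) delivery"
  | Local 'v "('v, 'e) qubit set" "('v, 'e) qubit matrix list" "nat \<Rightarrow> ('v, 'e) protocol"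

definition kraus_complete :: "'q set \<Rightarrow> 'q matrix list \<Rightarrow> bool" where
  "kraus_complete X Ks \<longleftrightarrow>
     (\<forall>A\<in>Pow X. \<forall>B\<in>Pow X. (\<Sum>K\<leftarrow>Ks. \<Sum>C\<in>Pow X. cnj (K C A) * K C B) = (if A = B then 1 else 0))"

definition kraus_apply :: "'q set \<Rightarrow> 'q matrix \<Rightarrow> 'q matrix \<Rightarrow> 'q matrix" where
  "kraus_apply X K \<rho> A B =
     (\<Sum>C\<in>Pow X. \<Sum>D\<in>Pow X. K (A \<inter> X) C * \<rho> ((A - X) \<union> C) ((B - X) \<union> D) * cnj (K (B \<inter> X) D))"

definition valid_delivery ::
    "('v, 'e) network \<Rightarrow> 'v demand \<Rightarrow> 'e set list \<Rightarrow> ('v, 'e) delivery \<Rightarrow> bool" where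
  "valid_delivery G D \<omega> r \<longleftrightarrow>
     (\<forall>x\<in>set r. session x \<in> D \<and>
        qubit1 x \<in> register G \<omega> (fst (session x)) \<and> qubit2 x \<in> register G \<omega> (snd (session x))) \<and>
     distinct (concat (map (\<lambda>x. [qubit1 x, qubit2 x]) r))"

primrec valid_protocol ::
    "('v, 'e) network \<Rightarrow> 'v demand \<Rightarrow> 'e set list \<Rightarrow> ('v, 'e) protocol \<Rightarrow> bool" where
  "valid_protocol G D \<omega> (Halt r) \<longleftrightarrow> valid_delivery G D \<omega> r"
| "valid_protocol G D \<omega> (Local v X Ks next) \<longleftrightarrow>
     v \<in> nodes G \<and> finite X \<and> X \<subseteq> register G \<omega> v \<and> kraus_complete X Ks \<and>
     (\<forall>j<length Ks. valid_protocol G D \<omega> (next j))"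

primrec deliveries :: "('v, 'e) protocol \<Rightarrow> ('v, 'e) delivery set" where
  "deliveries (Halt r) = {r}"
| "deliveries (Local v X Ks next) = (\<Union>j<length Ks. deliveries (next j))"

text \<open>
  \<open>branch P \<rho> r\<close> is the unnormalised state after running \<open>P\<close> on \<open>\<rho>\<close> and obtaining the delivery
  record \<open>r\<close>; its trace is the probability of \<open>r\<close>.
\<close>

primrec branch ::
    "('v, 'e) protocol \<Rightarrow> ('v, 'e) qubit matrix \<Rightarrow> ('v, 'e) delivery \<Rightarrow> ('v, 'e) qubit matrix" where
  "branch (Halt r') \<rho> r = (if r = r' then \<rho> else (\<lambda>A B. 0))"
| "branch (Local v X Ks next) \<rho> r =
     (\<lambda>A B. \<Sum>j<length Ks. branch (next j) (kraus_apply X (Ks ! j) \<rho>) r A B)"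


section \<open>Strategies and capacity\<close>

text \<open>
  A strategy chooses a protocol from the demand and the link record.  Restrictions on the permitted
  operations, on causality, or on the heralded link information that a node may use single out
  subclasses of the strategies satisfying \<open>locc_strategy\<close>.
\<close>

type_synonym ('v, 'e) strategy = "'v demand \<Rightarrow> 'e set list \<Rightarrow> ('v, 'e) protocol"

definition locc_strategy ::
    "('v, 'e) network \<Rightarrow> nat \<Rightarrow> nat \<Rightarrow> ('v, 'e) strategy \<Rightarrow> bool" where
  "locc_strategy G M W S \<longleftrightarrow>
     (\<forall>D\<in>set_pmf (demand_law G M). \<forall>\<omega>\<in>set_pmf (links_law G W). valid_protocol G D \<omega> (S D \<omega>))"

definition delivery_prob ::
    "('v, 'e) network \<Rightarrow> ('v, 'e) strategy \<Rightarrow> 'v demand \<Rightarrow> 'e set list \<Rightarrow> ('v, 'e) delivery \<Rightarrow> real"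
  where
  "delivery_prob G S D \<omega> r = Re (mtrace (branch (S D \<omega>) (supplied_state G \<omega>) r))"

definition conditional_state ::
    "('v, 'e) network \<Rightarrow> ('v, 'e) strategy \<Rightarrow> 'v demand \<Rightarrow> 'e set list \<Rightarrow> ('v, 'e) delivery \<Rightarrow>
     ('v, 'e) qubit matrix" where
  "conditional_state G S D \<omega> r A B =
     branch (S D \<omega>) (supplied_state G \<omega>) r A B / of_real (delivery_prob G S D \<omega> r)"

definition output_count ::
    "('v, 'e) network \<Rightarrow> real \<Rightarrow> ('v, 'e) strategy \<Rightarrow> 'v demand \<Rightarrow> 'e set list \<Rightarrow>
     ('v, 'e) delivery \<Rightarrow> 'v \<times> 'v \<Rightarrow> nat" where
  "output_count G F S D \<omega> r i =
     length (filter (\<lambda>x. session x = i \<and>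
       F \<le> bell_fidelity (conditional_state G S D \<omega> r) (qubit1 x) (qubit2 x)) r)"

definition expected_reward ::
    "('v, 'e) network \<Rightarrow> nat \<Rightarrow> real \<Rightarrow> nat \<Rightarrow> ('v, 'e) strategy \<Rightarrow> real" where
  "expected_reward G M F W S =
     measure_pmf.expectation (pair_pmf (demand_law G M) (links_law G W))
       (\<lambda>(D, \<omega>). \<Sum>r\<in>deliveries (S D \<omega>).
          delivery_prob G S D \<omega> r *
          (\<Sum>(s, t)\<in>D. distance G s t * real (output_count G F S D \<omega> r (s, t))))"

text \<open>
  \<open>Adm W\<close> is the declared class of admissible \<open>W\<close>-slot strategies.  The supremum is taken in the
  extended reals: for \<open>F \<le> 1/2\<close>, say, product states already meet the fidelity threshold and the
  number of outputs is unbounded.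
\<close>

definition capacity ::
    "('v, 'e) network \<Rightarrow> nat \<Rightarrow> real \<Rightarrow> (nat \<Rightarrow> ('v, 'e) strategy set) \<Rightarrow> nat \<Rightarrow> ereal" where
  "capacity G M F Adm W = (SUP S\<in>Adm W. ereal (1 / real W * expected_reward G M F W S))"

definition strategy_class ::
    "('v, 'e) network \<Rightarrow> nat \<Rightarrow> (nat \<Rightarrow> ('v, 'e) strategy set) \<Rightarrow> bool" where
  "strategy_class G M Adm \<longleftrightarrow>
     (\<forall>W\<ge>1. Adm W \<noteq> {} \<and> (\<forall>S\<in>Adm W. locc_strategy G M W S))"


section \<open>Concatenation\<close>

text \<open>
  The second protocol is moved \<open>k\<close> slots later.  It then only touches qubits of slots \<open>\<ge> k\<close>, so
  whatever the first one left unused is discarded.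
\<close>

primrec delay_qubit :: "nat \<Rightarrow> ('v, 'e) qubit \<Rightarrow> ('v, 'e) qubit" where
  "delay_qubit k (Half w e v) = Half (k + w) e v"
| "delay_qubit k (Memory w v n) = Memory (k + w) v n"

primrec delay_output :: "nat \<Rightarrow> ('v, 'e) bell_output \<Rightarrow> ('v, 'e) bell_output" where
  "delay_output k (Output i a b l) = Output i (delay_qubit k a) (delay_qubit k b) l"

definition delay_matrix :: "nat \<Rightarrow> ('v, 'e) qubit matrix \<Rightarrow> ('v, 'e) qubit matrix" where
  "delay_matrix k K A B = K (delay_qubit k -` A) (delay_qubit k -` B)"

primrec delay :: "nat \<Rightarrow> ('v, 'e) protocol \<Rightarrow> ('v, 'e) protocol" where
  "delay k (Halt r) = Halt (map (delay_output k) r)"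
| "delay k (Local v X Ks next) =
     Local v (delay_qubit k ` X) (map (delay_matrix k) Ks) (\<lambda>j. delay k (next j))"

primrec prepend_delivery :: "('v, 'e) delivery \<Rightarrow> ('v, 'e) protocol \<Rightarrow> ('v, 'e) protocol" where
  "prepend_delivery r (Halt r') = Halt (r @ r')"
| "prepend_delivery r (Local v X Ks next) = Local v X Ks (\<lambda>j. prepend_delivery r (next j))"

primrec run_then :: "('v, 'e) protocol \<Rightarrow> ('v, 'e) protocol \<Rightarrow> ('v, 'e) protocol" where
  "run_then (Halt r) Q = prepend_delivery r Q"
| "run_then (Local v X Ks next) Q = Local v X Ks (\<lambda>j. run_then (next j) Q)"

definition concatenation ::
    "nat \<Rightarrow> ('v, 'e) strategy \<Rightarrow> ('v, 'e) strategy \<Rightarrow> ('v, 'e) strategy" where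
  "concatenation k S T D \<omega> = run_then (S D (take k \<omega>)) (delay k (T D (drop k \<omega>)))"

definition closed_under_concatenation :: "(nat \<Rightarrow> ('v, 'e) strategy set) \<Rightarrow> bool" where
  "closed_under_concatenation Adm \<longleftrightarrow>
     (\<forall>k\<ge>1. \<forall>l\<ge>1. \<forall>S\<in>Adm k. \<forall>T\<in>Adm l. concatenation k S T \<in> Adm (k + l))"

end

theory Submission
  imports Defs
begin

text \<open>
  The total expected reward of a window is superadditive in its length: under a concatenation the
  state of the window is at all times a tensor product of an early and a late factor, because the
  supplied pairs of different slots are in a product state and each protocol only touches its own
  qubits. Hence the probabilities of delivery records multiply, the conditional state of a pair of
  records is the product of the two conditional states, the fidelity of an output only depends on
  its own factor, and expected rewards add exactly. Fekete's argument then applies: filling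
  \<open>W = q m + l\<close> slots with \<open>q\<close> copies of an \<open>m\<close>-slot strategy and \<open>l < m\<close> copies of a 1-slot
  strategy loses only a bounded reward.
\<close>

section \<open>Superadditive sets of rewards\<close>

text \<open>Rewards may be unbounded, so a capacity may be infinite. Fekete's argument is therefore
  run on single attainable rewards, which are real numbers and can be added and scaled freely;
  suprema only enter through comparisons. Two conventions shape the quantum part.
  \<open>Sum_any\<close> returns 0 on an infinite support, so traces add and factor only for
  matrices of finite support. \<open>delivery_prob\<close> is the real part of a trace, and real
  parts do not multiply, so the traces must be shown to be real. Hence finite support and Hermitian
  symmetry are carried through every branch. In the concatenation, the reward of one window is
  weighted with the total probability of the records of the other. Exact additivity thus needs this
  total to be 1, which rests on the completeness of the Kraus operators and on the unit trace of the
  supplied state.\<close>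

lemma ereal_capacity_limit:
  fixes R :: "nat \<Rightarrow> real set"
  assumes nonempty: "\<And>W. 1 \<le> W \<Longrightarrow> R W \<noteq> {}"
    and add: "\<And>k l x y. \<lbrakk>1 \<le> k; 1 \<le> l; x \<in> R k; y \<in> R l\<rbrakk> \<Longrightarrow> x + y \<in> R (k + l)"
  defines "c \<equiv> \<lambda>W. SUP x\<in>R W. ereal (1 / real W * x)"
  shows "c \<longlonglongrightarrow> (SUP W\<in>{1..}. c W)" and "1 \<le> W \<Longrightarrow> c 1 \<le> c W"
proof -
  \<comment> \<open>Copies are counted by \<open>Suc q\<close> because nothing is known about
    \<open>R 0\<close>; for the same reason an empty remainder \<open>l = 0\<close> is treated
    separately below.\<close>
  have mult: "real (Suc q) * x \<in> R (Suc q * m)" if "1 \<le> m" "x \<in> R m" for q m x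
  proof (induction q)
    case 0
    then show ?case using that by simp
  next
    case (Suc q)
    have "x + real (Suc q) * x \<in> R (m + Suc q * m)"
      using that Suc by (intro add) auto
    then show ?case by (simp add: algebra_simps)
  qed
  have upper: "ereal (x / real W) \<le> c W" if "x \<in> R W" for x W
    unfolding c_def using SUP_upper[OF that, of "\<lambda>x. ereal (1 / real W * x)"] by simp
  show "c 1 \<le> c W" if "1 \<le> W"
  proof -
    have "ereal x \<le> c W" if "x \<in> R 1" for x
    proof -
      have "real W * x \<in> R W" using mult[of 1 x "W - 1"] that \<open>1 \<le> W\<close> by simp
      from upper[OF this] show ?thesis using \<open>1 \<le> W\<close> by simp
    qed
    then show ?thesis unfolding c_def by (intro SUP_least) (simp add: c_def)
  qed
  show "c \<longlonglongrightarrow> (SUP W\<in>{1..}. c W)"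
  proof (rule order_tendstoI)
    fix a assume "(SUP W\<in>{1..}. c W) < a"
    then show "\<forall>\<^sub>F W in sequentially. c W < a"
      unfolding eventually_sequentially
      by (intro exI[of _ 1]) (meson SUP_upper atLeast_iff le_less_trans)
  next
    fix a assume "a < (SUP W\<in>{1..}. c W)"
    then obtain m x where m: "1 \<le> m" and x: "x \<in> R m" and "a < ereal (1 / real m * x)"
      unfolding less_SUP_iff c_def by auto
    \<comment> \<open>A real \<open>y\<close> strictly below the rate \<open>x / real m\<close>
      leaves a gain linear in \<open>W\<close>, which eventually exceeds any fixed loss. It also
      moves the comparison from \<open>ereal\<close>, where \<open>a\<close> may be minus infinity,
      to the reals.\<close>
    then obtain y where y: "a < ereal y" "y < x / real m"
      using ereal_dense2[of a "ereal (1 / real m * x)"] by auto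
    obtain x1 where x1: "x1 \<in> R 1" using nonempty[of 1] by auto
    \<comment> \<open>\<open>K\<close> bounds the loss on the remainder: fewer than \<open>m\<close>
      slots earn \<open>x1\<close> each instead of the average \<open>x / real m\<close>.\<close>
    define K where "K = real m * \<bar>x1 - x / real m\<bar>"
    obtain n :: nat where n: "K / (x / real m - y) < real n"
      using reals_Archimedean2 by blast
    have "a < c W" if W: "W \<ge> max n m" for W
    proof -
      \<comment> \<open>Since \<open>W \<ge> m\<close>, the quotient is positive, so subtracting 1
        is exact and \<open>Suc q\<close> is the number of full blocks.\<close>
      define q where "q = W div m - 1"
      define l where "l = W mod m"
      have "1 \<le> W div m" using W m by (metis div_greater_zero_iff max.bounded_iff less_eq_Suc_le One_nat_def)
      then have Weq: "W = Suc q * m + l" unfolding q_def l_def by simp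
      have l: "l < m" using m by (simp add: l_def)
      define z where "z = real (Suc q) * x + real l * x1"
      have z: "z \<in> R W"
      proof (cases "l = 0")
        case True
        then show ?thesis using mult[OF m x, of q] Weq z_def by simp
      next
        case False
        then have "real l * x1 \<in> R l" using mult[OF _ x1, of "l - 1"] by simp
        then show ?thesis
          unfolding z_def Weq using False m by (intro add mult x) auto
      qed
      have "real W * y < real W * (x / real m) - K"
      proof -
        have "K < real n * (x / real m - y)" using n y(2) by (simp add: field_simps)
        also have "\<dots> \<le> real W * (x / real m - y)" using W y(2) by (intro mult_right_mono) auto
        finally show ?thesis by (simp add: algebra_simps)
      qed
      also have "\<dots> \<le> real W * (x / real m) + real l * (x1 - x / real m)"
      proof -
        have "real l * (x / real m - x1) \<le> real l * \<bar>x1 - x / real m\<bar>"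
          by (intro mult_left_mono) auto
        also have "\<dots> \<le> real m * \<bar>x1 - x / real m\<bar>"
          using l by (intro mult_right_mono) auto
        finally have "real l * (x / real m - x1) \<le> real m * \<bar>x1 - x / real m\<bar>" .
        then show ?thesis by (simp add: K_def algebra_simps)
      qed
      also have "\<dots> = z" using m by (simp add: z_def Weq field_simps)
      finally have "y < z / real W" using W m by (simp add: field_simps)
      then show ?thesis using upper[OF z] y(1)
        by (metis ereal_less(2) less_ereal.simps(1) order_less_le_trans order_less_trans)
    qed
    then show "\<forall>\<^sub>F W in sequentially. a < c W" unfolding eventually_sequentially by blast
  qed
qed


section \<open>Tensor products of early and late states\<close>

definition early :: "nat \<Rightarrow> ('v, 'e) qubit set" where
  "early k = {q. slot q < k}"

text \<open>
  The tensor product of a state of the qubits of the first \<open>k\<close> slots and a delayed state; taking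
  preimages under \<open>delay_qubit k\<close> already ignores the early qubits.
\<close>

definition joint ::
    "nat \<Rightarrow> ('v, 'e) qubit matrix \<Rightarrow> ('v, 'e) qubit matrix \<Rightarrow> ('v, 'e) qubit matrix" where
  "joint k \<sigma> \<tau> A B =
     \<sigma> (A \<inter> early k) (B \<inter> early k) * \<tau> (delay_qubit k -` A) (delay_qubit k -` B)"

text \<open>A single finite \<open>Z\<close> bounds row and column labels at once, and a Kraus
  operator on \<open>X\<close> enlarges it by \<open>X\<close> only. The bound \<open>R\<close>
  keeps an early factor inside \<open>early k\<close>: \<open>joint\<close> reads its first factor
  only at subsets of \<open>early k\<close> and would lose all other entries.\<close>

definition finitary :: "'q set \<Rightarrow> 'q matrix \<Rightarrow> bool" where
  "finitary R \<rho> \<longleftrightarrow> (\<exists>Z. finite Z \<and> Z \<subseteq> R \<and> (\<forall>A B. \<rho> A B \<noteq> 0 \<longrightarrow> A \<subseteq> Z \<and> B \<subseteq> Z))"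

text \<open>Used through the diagonal: its entries are real, so a trace equals its own real part,
  which links the complex product formula for traces to the real-valued
  \<open>delivery_prob\<close>.\<close>

definition hermitian :: "'q matrix \<Rightarrow> bool" where
  "hermitian \<rho> \<longleftrightarrow> (\<forall>A B. cnj (\<rho> A B) = \<rho> B A)"

lemma slot_delay_qubit [simp]: "slot (delay_qubit k q) = k + slot q"
  by (cases q) auto

lemma inj_delay_qubit: "inj (delay_qubit k)"
proof
  fix p q :: "('v, 'e) qubit"
  show "delay_qubit k p = delay_qubit k q \<Longrightarrow> p = q" by (cases p; cases q) auto
qed

lemma delay_qubit_eq_iff [simp]: "delay_qubit k p = delay_qubit k q \<longleftrightarrow> p = q"
  using inj_delay_qubit by (auto dest: injD)

lemma delay_qubit_not_early [simp]: "delay_qubit k q \<notin> early k"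
  by (simp add: early_def)

lemma vimage_early: "A \<subseteq> early k \<Longrightarrow> delay_qubit k -` A = {}"
  using delay_qubit_not_early by fastforce

lemma late_eq_delay: "q \<notin> early k \<Longrightarrow> q \<in> range (delay_qubit k)"
proof (cases q)
  case (Half w e v)
  moreover assume "q \<notin> early k"
  ultimately have "q = delay_qubit k (Half (w - k) e v)" by (simp add: early_def)
  then show ?thesis by blast
next
  case (Memory w v n)
  moreover assume "q \<notin> early k"
  ultimately have "q = delay_qubit k (Memory (w - k) v n)" by (simp add: early_def)
  then show ?thesis by blast
qed

lemma early_late_split: "(A \<inter> early k) \<union> delay_qubit k ` (delay_qubit k -` A) = A"
  using late_eq_delay by fastforce

text \<open>Cutting a set of qubits into its early part and its late part, shifted back by
  \<open>k\<close> slots, loses nothing, and every pair of such parts arises from exactly one set.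
  The finite carriers \<open>Z\<close> and \<open>Y\<close> turn the sum into a product of two
  finite sums.\<close>

lemma Sum_any_early_late:
  fixes f g :: "('v, 'e) qubit set \<Rightarrow> complex"
  assumes f: "finite Z" "Z \<subseteq> early k" "\<And>A. f A \<noteq> 0 \<Longrightarrow> A \<subseteq> Z"
    and g: "finite Y" "\<And>A. g A \<noteq> 0 \<Longrightarrow> A \<subseteq> Y"
  shows "Sum_any (\<lambda>A. f (A \<inter> early k) * g (delay_qubit k -` A)) = Sum_any f * Sum_any g"
proof -
  let ?u = "\<lambda>(A, B). A \<union> delay_qubit k ` B"
  let ?h = "\<lambda>A. f (A \<inter> early k) * g (delay_qubit k -` A)"
  have parts: "?u p \<inter> early k = fst p" "delay_qubit k -` ?u p = snd p" if P: "p \<in> Pow Z \<times> Pow Y" for p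
  proof -
    obtain A B where p: "p = (A, B)" "A \<subseteq> Z" using P by auto
    then have A: "A \<subseteq> early k" using f(2) by auto
    then show "?u p \<inter> early k = fst p" using p by auto
    show "delay_qubit k -` ?u p = snd p" using p vimage_early[OF A] by auto
  qed
  have "inj_on ?u (Pow Z \<times> Pow Y)"
    by (rule inj_on_inverseI[of _ "\<lambda>A. (A \<inter> early k, delay_qubit k -` A)"]) (use parts in auto)
  moreover have "{A. ?h A \<noteq> 0} \<subseteq> ?u ` (Pow Z \<times> Pow Y)"
  proof
    fix A assume "A \<in> {A. ?h A \<noteq> 0}"
    then have "(A \<inter> early k, delay_qubit k -` A) \<in> Pow Z \<times> Pow Y" using f(3) g(2) by auto
    moreover have "A = ?u (A \<inter> early k, delay_qubit k -` A)" using early_late_split[of A k] by simp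
    ultimately show "A \<in> ?u ` (Pow Z \<times> Pow Y)" by (rule rev_image_eqI)
  qed
  ultimately have "Sum_any ?h = (\<Sum>p\<in>Pow Z \<times> Pow Y. ?h (?u p))"
    using f(1) g(1) by (subst Sum_any.expand_superset[of "?u ` (Pow Z \<times> Pow Y)"])
      (auto simp: sum.reindex)
  also have "\<dots> = (\<Sum>p\<in>Pow Z \<times> Pow Y. f (fst p) * g (snd p))"
    by (intro sum.cong refl) (simp only: parts)
  also have "\<dots> = sum f (Pow Z) * sum g (Pow Y)"
    by (simp add: sum_product sum.cartesian_product case_prod_unfold)
  also have "sum f (Pow Z) = Sum_any f"
    using f by (subst Sum_any.expand_superset[of "Pow Z"]) auto
  also have "sum g (Pow Y) = Sum_any g"
    using g by (subst Sum_any.expand_superset[of "Pow Y"]) auto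
  finally show ?thesis .
qed

section \<open>Traces, reduced states and fidelities of a product state\<close>

lemma mtrace_joint:
  assumes "finitary (early k) \<sigma>" "finitary R \<tau>"
  shows "mtrace (joint k \<sigma> \<tau>) = mtrace \<sigma> * mtrace \<tau>"
proof -
  obtain Z where "finite Z" "Z \<subseteq> early k" "\<And>A B. \<sigma> A B \<noteq> 0 \<Longrightarrow> A \<subseteq> Z \<and> B \<subseteq> Z"
    using assms(1) unfolding finitary_def by blast
  moreover obtain Y where "finite Y" "\<And>A B. \<tau> A B \<noteq> 0 \<Longrightarrow> A \<subseteq> Y \<and> B \<subseteq> Y"
    using assms(2) unfolding finitary_def by blast
  ultimately show ?thesis
    unfolding mtrace_def joint_def
    by (intro Sum_any_early_late[of Z k "\<lambda>A. \<sigma> A A" Y "\<lambda>A. \<tau> A A"]) auto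
qed

text \<open>The label \<open>C\<close> of the traced-out qubits splits as well: its early part has
  to avoid \<open>Q\<close>, while its late part is unrestricted and therefore sums to the full
  trace of the late factor.\<close>

lemma reduced_state_joint_early:
  assumes "finitary (early k) \<sigma>" "finitary R \<tau>" "Q \<subseteq> early k" "A \<subseteq> Q" "B \<subseteq> Q"
  shows "reduced_state Q (joint k \<sigma> \<tau>) A B = reduced_state Q \<sigma> A B * mtrace \<tau>"
proof -
  obtain Z where Z: "finite Z" "Z \<subseteq> early k" "\<And>A B. \<sigma> A B \<noteq> 0 \<Longrightarrow> A \<subseteq> Z \<and> B \<subseteq> Z"
    using assms(1) unfolding finitary_def by blast
  obtain Y where Y: "finite Y" "\<And>A B. \<tau> A B \<noteq> 0 \<Longrightarrow> A \<subseteq> Y \<and> B \<subseteq> Y"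
    using assms(2) unfolding finitary_def by blast
  let ?f = "\<lambda>C. if C \<inter> Q = {} then \<sigma> (A \<union> C) (B \<union> C) else 0"
  have "(if C \<inter> Q = {} then joint k \<sigma> \<tau> (A \<union> C) (B \<union> C) else 0) =
      ?f (C \<inter> early k) * \<tau> (delay_qubit k -` C) (delay_qubit k -` C)" for C
  proof -
    have "C \<inter> early k \<inter> Q = C \<inter> Q" "(A \<union> C) \<inter> early k = A \<union> (C \<inter> early k)"
      "(B \<union> C) \<inter> early k = B \<union> (C \<inter> early k)" using assms(3-5) by auto
    moreover have "delay_qubit k -` (A \<union> C) = delay_qubit k -` C"
      "delay_qubit k -` (B \<union> C) = delay_qubit k -` C"
      using assms(3-5) vimage_early[of A k] vimage_early[of B k] by auto
    ultimately show ?thesis by (simp add: joint_def)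
  qed
  then have "reduced_state Q (joint k \<sigma> \<tau>) A B =
      Sum_any (\<lambda>C. ?f (C \<inter> early k) * \<tau> (delay_qubit k -` C) (delay_qubit k -` C))"
    by (simp only: reduced_state_def)
  also have "\<dots> = Sum_any ?f * mtrace \<tau>"
    unfolding mtrace_def
  proof (rule Sum_any_early_late[of Z k ?f Y "\<lambda>C. \<tau> C C"])
    show "C \<subseteq> Z" if "?f C \<noteq> 0" for C
      using that Z(3)[of "A \<union> C" "B \<union> C"] by (auto split: if_splits)
  qed (use Z(1,2) Y in auto)
  finally show ?thesis by (simp add: reduced_state_def)
qed

lemma reduced_state_joint_late:
  assumes "finitary (early k) \<sigma>" "finitary R \<tau>"
  shows "reduced_state (delay_qubit k ` Q) (joint k \<sigma> \<tau>) (delay_qubit k ` A) (delay_qubit k ` B) =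
    mtrace \<sigma> * reduced_state Q \<tau> A B"
proof -
  obtain Z where Z: "finite Z" "Z \<subseteq> early k" "\<And>A B. \<sigma> A B \<noteq> 0 \<Longrightarrow> A \<subseteq> Z \<and> B \<subseteq> Z"
    using assms(1) unfolding finitary_def by blast
  obtain Y where Y: "finite Y" "\<And>A B. \<tau> A B \<noteq> 0 \<Longrightarrow> A \<subseteq> Y \<and> B \<subseteq> Y"
    using assms(2) unfolding finitary_def by blast
  let ?g = "\<lambda>C. if C \<inter> Q = {} then \<tau> (A \<union> C) (B \<union> C) else 0"
  have "(if C \<inter> delay_qubit k ` Q = {}
        then joint k \<sigma> \<tau> (delay_qubit k ` A \<union> C) (delay_qubit k ` B \<union> C) else 0) =
      \<sigma> (C \<inter> early k) (C \<inter> early k) * ?g (delay_qubit k -` C)" for C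
  proof -
    have "C \<inter> delay_qubit k ` Q = {} \<longleftrightarrow> delay_qubit k -` C \<inter> Q = {}" by auto
    moreover have "(delay_qubit k ` X \<union> C) \<inter> early k = C \<inter> early k" for X by auto
    moreover have "delay_qubit k -` (delay_qubit k ` X \<union> C) = X \<union> delay_qubit k -` C" for X by auto
    ultimately show ?thesis by (simp add: joint_def)
  qed
  then have "reduced_state (delay_qubit k ` Q) (joint k \<sigma> \<tau>) (delay_qubit k ` A) (delay_qubit k ` B) =
      Sum_any (\<lambda>C. \<sigma> (C \<inter> early k) (C \<inter> early k) * ?g (delay_qubit k -` C))"
    by (simp only: reduced_state_def)
  also have "\<dots> = mtrace \<sigma> * Sum_any ?g"
    unfolding mtrace_def
  proof (rule Sum_any_early_late[of Z k "\<lambda>C. \<sigma> C C" Y ?g])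
    show "C \<subseteq> Y" if "?g C \<noteq> 0" for C
      using that Y(2)[of "A \<union> C" "B \<union> C"] by (auto split: if_splits)
  qed (use Z Y(1) in auto)
  finally show ?thesis by (simp add: reduced_state_def)
qed

text \<open>The other factor enters only as the scalar \<open>mtrace \<tau>\<close>. This is why
  fidelities are compared for normalised conditional states and not for the branches
  themselves.\<close>

lemma bell_fidelity_joint_early:
  assumes "finitary (early k) \<sigma>" "finitary R \<tau>" "slot a < k" "slot b < k" "mtrace \<tau> = 1"
  shows "bell_fidelity (joint k \<sigma> \<tau>) a b = bell_fidelity \<sigma> a b"
proof -
  have "reduced_state {a, b} (joint k \<sigma> \<tau>) A B = reduced_state {a, b} \<sigma> A B"
    if "A \<in> Pow {a, b}" "B \<in> Pow {a, b}" for A B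
    using reduced_state_joint_early[OF assms(1,2), of "{a, b}" A B] that assms(3-5)
    by (auto simp: early_def)
  then show ?thesis
    unfolding bell_fidelity_def by (intro arg_cong[where f = Re] sum.cong refl) simp
qed

lemma bell_fidelity_joint_late:
  assumes "finitary (early k) \<sigma>" "finitary R \<tau>" "mtrace \<sigma> = 1"
  shows "bell_fidelity (joint k \<sigma> \<tau>) (delay_qubit k a) (delay_qubit k b) = bell_fidelity \<tau> a b"
proof -
  let ?d = "delay_qubit k"
  have Pow: "Pow {?d a, ?d b} = image ?d ` Pow {a, b}"
    using image_Pow_surj[of ?d "{a, b}" "{?d a, ?d b}"] by (simp del: Pow_insert)
  have inj: "inj_on (image ?d) \<S>" for \<S>
    by (rule inj_on_subset[OF _ subset_UNIV]) (simp add: inj_image_eq_iff[OF inj_delay_qubit] inj_def)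
  have "bell_vector (?d a) (?d b) (?d ` A) = bell_vector a b A" for A
    using inj_image_eq_iff[OF inj_delay_qubit, of k A "{a, b}"] by (simp add: bell_vector_def)
  moreover have "reduced_state {?d a, ?d b} (joint k \<sigma> \<tau>) (?d ` A) (?d ` B) =
      reduced_state {a, b} \<tau> A B" for A B
    using reduced_state_joint_late[OF assms(1,2), of "{a, b}" A B] assms(3) by simp
  ultimately show ?thesis
    unfolding bell_fidelity_def Pow
    by (simp add: sum.reindex[OF inj] del: Pow_insert)
qed

section \<open>Local operations on one factor of a product state\<close>

lemma kraus_apply_joint_early:
  assumes "X \<subseteq> early k"
  shows "kraus_apply X K (joint k \<sigma> \<tau>) = joint k (kraus_apply X K \<sigma>) \<tau>"
proof (intro ext)
  fix A B
  have 1: "((A - X) \<union> C) \<inter> early k = (A \<inter> early k - X) \<union> C" if "C \<in> Pow X" for A C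
    using assms that by auto
  have 2: "delay_qubit k -` ((A - X) \<union> C) = delay_qubit k -` A" if "C \<in> Pow X" for A C
    using assms that delay_qubit_not_early by fastforce
  have 3: "A \<inter> early k \<inter> X = A \<inter> X" for A using assms by auto
  show "kraus_apply X K (joint k \<sigma> \<tau>) A B = joint k (kraus_apply X K \<sigma>) \<tau> A B"
    unfolding kraus_apply_def joint_def sum_distrib_right 3
    by (intro sum.cong refl) (simp only: 1 2 mult_ac)
qed

lemma kraus_apply_joint_late:
  "kraus_apply (delay_qubit k ` X) (delay_matrix k K) (joint k \<sigma> \<tau>) =
     joint k \<sigma> (kraus_apply X K \<tau>)"
proof (intro ext)
  fix A B
  let ?d = "delay_qubit k"
  have Pow: "Pow (?d ` X) = image ?d ` Pow X" by (simp add: image_Pow_surj[OF refl])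
  have inj: "inj_on (image ?d) \<S>" for \<S>
    by (rule inj_on_subset[OF _ subset_UNIV]) (simp add: inj_image_eq_iff[OF inj_delay_qubit] inj_def)
  have 1: "((A - ?d ` X) \<union> ?d ` C) \<inter> early k = A \<inter> early k" for A C by auto
  have 2: "?d -` ((A - ?d ` X) \<union> ?d ` C) = (?d -` A - X) \<union> C" for A C by auto
  have 3: "?d -` (A \<inter> ?d ` X) = ?d -` A \<inter> X" "?d -` (?d ` C) = C" for A C by auto
  show "kraus_apply (?d ` X) (delay_matrix k K) (joint k \<sigma> \<tau>) A B =
      joint k \<sigma> (kraus_apply X K \<tau>) A B"
    unfolding kraus_apply_def joint_def Pow sum.reindex[OF inj] delay_matrix_def o_def 1 2 3
      sum_distrib_left
    by (intro sum.cong refl) (simp only: mult_ac)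
qed

lemma joint_sum_left: "joint k (\<lambda>A B. \<Sum>j\<in>J. \<sigma> j A B) \<tau> = (\<lambda>A B. \<Sum>j\<in>J. joint k (\<sigma> j) \<tau> A B)"
  by (simp add: joint_def sum_distrib_right fun_eq_iff)

lemma joint_sum_right: "joint k \<sigma> (\<lambda>A B. \<Sum>j\<in>J. \<tau> j A B) = (\<lambda>A B. \<Sum>j\<in>J. joint k \<sigma> (\<tau> j) A B)"
  by (simp add: joint_def sum_distrib_left fun_eq_iff)

lemma joint_zero [simp]:
  "joint k (\<lambda>A B. 0) \<tau> = (\<lambda>A B. 0)" "joint k \<sigma> (\<lambda>A B. 0) = (\<lambda>A B. 0)"
  by (simp_all add: joint_def fun_eq_iff)


section \<open>Runs of concatenated protocols\<close>

definition early_delivery :: "nat \<Rightarrow> ('v, 'e) delivery \<Rightarrow> bool" where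
  "early_delivery k r \<longleftrightarrow> (\<forall>x\<in>set r. slot (qubit1 x) < k \<and> slot (qubit2 x) < k)"

lemma delay_output_sel [simp]:
  "session (delay_output k x) = session x"
  "qubit1 (delay_output k x) = delay_qubit k (qubit1 x)"
  "qubit2 (delay_output k x) = delay_qubit k (qubit2 x)"
  by (cases x; simp)+

lemma inj_delay_output: "inj (delay_output k)"
proof
  fix x y :: "('v, 'e) bell_output"
  show "delay_output k x = delay_output k y \<Longrightarrow> x = y" by (cases x; cases y) auto
qed

text \<open>
  The two parts of a concatenated delivery record can be told apart by the slots of their qubits, so
  records of a concatenation correspond to pairs of records and their probabilities do not merge.
\<close>

lemma append_delayed_eq_iff:
  assumes "early_delivery k r" "early_delivery k s"
  shows "r @ map (delay_output k) r' = s @ map (delay_output k) s' \<longleftrightarrow> r = s \<and> r' = s'"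
proof
  assume eq: "r @ map (delay_output k) r' = s @ map (delay_output k) s'"
  let ?early = "filter (\<lambda>x. slot (qubit1 x) < k)"
  have early: "?early (u @ map (delay_output k) u') = u" if "early_delivery k u" for u u'
    using that by (simp add: early_delivery_def filter_empty_conv)
  from arg_cong[OF eq, of ?early] have "r = s" by (simp only: early assms)
  then show "r = s \<and> r' = s'"
    using eq by (simp add: inj_map_eq_map[OF inj_delay_output])
qed simp

lemma register_early: "register G \<omega> v \<subseteq> early (length \<omega>)"
  by (auto simp: register_def early_def)

lemma finite_deliveries: "finite (deliveries P)"
  by (induction P) auto

lemma valid_protocol_early_delivery:
  "valid_protocol G D \<omega> P \<Longrightarrow> r \<in> deliveries P \<Longrightarrow> early_delivery (length \<omega>) r"
proof (induction P)
  case (Halt r')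
  then show ?case
    using register_early[of G \<omega>]
    by (auto simp: valid_delivery_def early_delivery_def early_def subset_iff)
qed auto

lemma deliveries_prepend_delivery: "deliveries (prepend_delivery r P) = (@) r ` deliveries P"
  by (induction P) auto

lemma deliveries_run_then:
  "deliveries (run_then P Q) = (\<lambda>(r, s). r @ s) ` (deliveries P \<times> deliveries Q)"
proof (induction P)
  case (Local v X Ks "next")
  then have "deliveries (run_then (Local v X Ks next) Q) =
      (\<Union>j<length Ks. (\<lambda>(r, s). r @ s) ` (deliveries (next j) \<times> deliveries Q))"
    by simp
  then show ?case by (simp add: image_UN[symmetric] Sigma_Union del: image_UN)
qed (auto simp: deliveries_prepend_delivery image_iff)

lemma deliveries_delay: "deliveries (delay k P) = map (delay_output k) ` deliveries P"
  by (induction P) auto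

lemma branch_not_delivered: "r \<notin> deliveries P \<Longrightarrow> branch P \<rho> r = (\<lambda>A B. 0)"
  by (induction P arbitrary: \<rho>) auto

text \<open>Once the early protocol has halted with \<open>s\<close>, the late one can only complete
  records that begin with \<open>s\<close>. A record with another early part \<open>r\<close> thus
  gets weight 0 at every leaf, matching the zero branch that \<open>Halt s\<close> assigns to
  \<open>r\<close>.\<close>

lemma branch_prepend_delayed:
  assumes "early_delivery k r" "early_delivery k s"
  shows "branch (prepend_delivery s (delay k Q)) (joint k \<sigma> \<tau>) (r @ map (delay_output k) r') =
    (if r = s then joint k \<sigma> (branch Q \<tau> r') else (\<lambda>A B. 0))"
proof (induction Q arbitrary: \<tau>)
  case (Halt s')
  then show ?case using append_delayed_eq_iff[OF assms, of r' s'] by auto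
next
  case (Local v X Ks "next")
  then show ?case
    by (auto simp: kraus_apply_joint_late joint_sum_right)
qed

text \<open>The same late protocol \<open>Q\<close> hangs at every leaf of \<open>P\<close>, and
  \<open>\<tau>\<close> stays untouched until a leaf is reached. The late factor is therefore common
  to all leaves with record \<open>r\<close>, and \<open>joint\<close>, being linear in its first
  factor, collects their sum.\<close>

lemma branch_run_then_delayed:
  assumes "valid_protocol G D \<omega> P" "early_delivery (length \<omega>) r"
  shows "branch (run_then P (delay (length \<omega>) Q)) (joint (length \<omega>) \<sigma> \<tau>)
      (r @ map (delay_output (length \<omega>)) r') = joint (length \<omega>) (branch P \<sigma> r) (branch Q \<tau> r')"
  using assms(1)
proof (induction P arbitrary: \<sigma>)
  case (Halt s)
  then have "early_delivery (length \<omega>) s"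
    using valid_protocol_early_delivery[of G D \<omega> "Halt s" s] by simp
  then show ?case using branch_prepend_delayed[OF assms(2)] by auto
next
  case (Local v X Ks "next")
  then have X: "X \<subseteq> early (length \<omega>)" using register_early[of G \<omega> v] by auto
  have IH: "branch (run_then (next j) (delay (length \<omega>) Q)) (joint (length \<omega>) \<sigma>' \<tau>)
      (r @ map (delay_output (length \<omega>)) r') = joint (length \<omega>) (branch (next j) \<sigma>' r) (branch Q \<tau> r')"
    if "j < length Ks" for j \<sigma>'
    using Local that by auto
  show ?case by (simp add: kraus_apply_joint_early[OF X] IH joint_sum_left)
qed

section \<open>Finite support and Hermitian symmetry along a run\<close>

lemma finitary_zero: "finitary R (\<lambda>A B. 0)"
  unfolding finitary_def by (intro exI[of _ "{}"]) simp

lemma finitary_sum: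
  assumes "finite J" "\<And>j. j \<in> J \<Longrightarrow> finitary R (\<rho> j)"
  shows "finitary R (\<lambda>A B. \<Sum>j\<in>J. \<rho> j A B)"
proof -
  have "\<forall>j\<in>J. \<exists>Z. finite Z \<and> Z \<subseteq> R \<and> (\<forall>A B. \<rho> j A B \<noteq> 0 \<longrightarrow> A \<subseteq> Z \<and> B \<subseteq> Z)"
    using assms(2) unfolding finitary_def by (rule ballI)
  from bchoice[OF this] obtain Z where "\<forall>j\<in>J. finite (Z j) \<and> Z j \<subseteq> R \<and>
      (\<forall>A B. \<rho> j A B \<noteq> 0 \<longrightarrow> A \<subseteq> Z j \<and> B \<subseteq> Z j)" by (elim exE)
  then have Z: "finite (Z j)" "Z j \<subseteq> R" "\<And>A B. \<rho> j A B \<noteq> 0 \<Longrightarrow> A \<subseteq> Z j \<and> B \<subseteq> Z j"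
    if "j \<in> J" for j
    using that by blast+
  have "A \<subseteq> (\<Union>j\<in>J. Z j) \<and> B \<subseteq> (\<Union>j\<in>J. Z j)" if nonzero: "(\<Sum>j\<in>J. \<rho> j A B) \<noteq> 0" for A B
  proof -
    obtain j where j: "j \<in> J" "\<rho> j A B \<noteq> 0"
      using nonzero by (rule sum.not_neutral_contains_not_neutral)
    then show ?thesis using Z(3)[OF j] by auto
  qed
  then show ?thesis
    unfolding finitary_def using Z(1,2) assms(1) by (intro exI[of _ "\<Union>j\<in>J. Z j"]) (auto dest: subsetD[OF Z(2)])
qed

lemma kraus_apply_support:
  assumes "\<And>A B. \<rho> A B \<noteq> 0 \<Longrightarrow> A \<subseteq> Z \<and> B \<subseteq> Z" "kraus_apply X K \<rho> A B \<noteq> 0"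
  shows "A \<subseteq> Z \<union> X \<and> B \<subseteq> Z \<union> X"
proof -
  obtain C D where "\<rho> ((A - X) \<union> C) ((B - X) \<union> D) \<noteq> 0"
  proof (rule ccontr)
    assume "\<not> thesis"
    then have "\<rho> ((A - X) \<union> C) ((B - X) \<union> D) = 0" for C D using that by blast
    then show False using assms(2) by (simp add: kraus_apply_def)
  qed
  from assms(1)[OF this] show ?thesis by auto
qed

lemma finitary_kraus_apply:
  assumes "finitary R \<rho>" "finite X" "X \<subseteq> R"
  shows "finitary R (kraus_apply X K \<rho>)"
proof -
  obtain Z where Z: "finite Z" "Z \<subseteq> R" "\<And>A B. \<rho> A B \<noteq> 0 \<Longrightarrow> A \<subseteq> Z \<and> B \<subseteq> Z"
    using assms(1) unfolding finitary_def by blast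
  have "\<forall>A B. kraus_apply X K \<rho> A B \<noteq> 0 \<longrightarrow> A \<subseteq> Z \<union> X \<and> B \<subseteq> Z \<union> X"
    using kraus_apply_support[OF Z(3)] by blast
  then show ?thesis
    unfolding finitary_def using Z(1,2) assms(2,3)
    by (intro exI[of _ "Z \<union> X"] conjI) (simp_all only: finite_Un Un_subset_iff simp_thms)
qed

lemma hermitian_kraus_apply:
  assumes "hermitian \<rho>"
  shows "hermitian (kraus_apply X K \<rho>)"
  unfolding hermitian_def
proof (intro allI)
  fix A B
  have \<rho>: "cnj (\<rho> A B) = \<rho> B A" for A B using assms by (simp add: hermitian_def)
  show "cnj (kraus_apply X K \<rho> A B) = kraus_apply X K \<rho> B A"
    unfolding kraus_apply_def cnj_sum complex_cnj_mult complex_cnj_cnj \<rho>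
    by (rule trans[OF sum.swap]) (intro sum.cong refl, simp)
qed

lemma finitary_branch:
  assumes "valid_protocol G D \<omega> P" "finitary (early (length \<omega>)) \<rho>"
  shows "finitary (early (length \<omega>)) (branch P \<rho> r)"
  using assms
proof (induction P arbitrary: \<rho>)
  case (Halt s)
  then show ?case by (simp add: finitary_zero)
next
  case (Local v X Ks "next")
  then have "X \<subseteq> early (length \<omega>)" "finite X" using register_early[of G \<omega> v] by auto
  then have "finitary (early (length \<omega>)) (branch (next j) (kraus_apply X (Ks ! j) \<rho>) r)"
    if "j < length Ks" for j
    using Local.prems that by (intro Local.IH[OF rangeI] finitary_kraus_apply) auto
  then show ?case by (auto intro!: finitary_sum)
qed

lemma hermitian_branch: "hermitian \<rho> \<Longrightarrow> hermitian (branch P \<rho> r)"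
proof (induction P arbitrary: \<rho>)
  case (Halt s)
  then show ?case by (simp add: hermitian_def)
next
  case (Local v X Ks "next")
  have "hermitian (branch (next j) (kraus_apply X (Ks ! j) \<rho>) r)" for j
    by (intro Local.IH hermitian_kraus_apply Local.prems) auto
  then have "cnj (branch (next j) (kraus_apply X (Ks ! j) \<rho>) r A B) =
      branch (next j) (kraus_apply X (Ks ! j) \<rho>) r B A" for j A B
    unfolding hermitian_def by simp
  then show ?case by (simp add: hermitian_def cnj_sum)
qed

lemma mtrace_hermitian: "hermitian \<rho> \<Longrightarrow> mtrace \<rho> = of_real (Re (mtrace \<rho>))"
proof -
  assume "hermitian \<rho>"
  then have "Im (\<rho> A A) = Im (cnj (\<rho> A A))" for A unfolding hermitian_def by metis
  then have "Im (\<rho> A A) = 0" for A by simp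
  then have "Im (mtrace \<rho>) = 0" by (simp add: mtrace_def Sum_any.expand_set)
  then show ?thesis by (simp add: complex_eq_iff)
qed

section \<open>Conservation of the total trace\<close>

lemma mtrace_sum:
  assumes "finite J" "\<And>j. j \<in> J \<Longrightarrow> finitary R (\<rho> j)"
  shows "mtrace (\<lambda>A B. \<Sum>j\<in>J. \<rho> j A B) = (\<Sum>j\<in>J. mtrace (\<rho> j))"
proof -
  have "\<forall>j\<in>J. \<exists>Z. finite Z \<and> Z \<subseteq> R \<and> (\<forall>A B. \<rho> j A B \<noteq> 0 \<longrightarrow> A \<subseteq> Z \<and> B \<subseteq> Z)"
    using assms(2) unfolding finitary_def by (rule ballI)
  from bchoice[OF this] obtain Z where
    "\<forall>j\<in>J. finite (Z j) \<and> Z j \<subseteq> R \<and> (\<forall>A B. \<rho> j A B \<noteq> 0 \<longrightarrow> A \<subseteq> Z j \<and> B \<subseteq> Z j)"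
    by (elim exE)
  then have Z: "finite (Z j)" "\<And>A. \<rho> j A A \<noteq> 0 \<Longrightarrow> A \<subseteq> Z j" if "j \<in> J" for j
    using that by blast+
  \<comment> \<open>A common carrier is needed because each \<open>Sum_any\<close> runs over its own
    support, and cancellation can make the support of the sum smaller than those of the
    summands.\<close>
  let ?Z = "Pow (\<Union>j\<in>J. Z j)"
  have fin: "finite ?Z" using Z(1) assms(1) by auto
  have "mtrace (\<rho> j) = (\<Sum>A\<in>?Z. \<rho> j A A)" if "j \<in> J" for j
    unfolding mtrace_def using Z(2)[OF that] that by (intro Sum_any.expand_superset fin) blast
  moreover have "mtrace (\<lambda>A B. \<Sum>j\<in>J. \<rho> j A B) = (\<Sum>A\<in>?Z. \<Sum>j\<in>J. \<rho> j A A)"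
    unfolding mtrace_def
  proof (intro Sum_any.expand_superset fin subsetI)
    fix A assume "A \<in> {A. (\<Sum>j\<in>J. \<rho> j A A) \<noteq> 0}"
    then have "(\<Sum>j\<in>J. \<rho> j A A) \<noteq> 0" by simp
    then obtain j where j: "j \<in> J" "\<rho> j A A \<noteq> 0" by (rule sum.not_neutral_contains_not_neutral)
    then show "A \<in> ?Z" using Z(2)[OF j] by auto
  qed
  moreover have "(\<Sum>A\<in>?Z. \<Sum>j\<in>J. \<rho> j A A) = (\<Sum>j\<in>J. \<Sum>A\<in>?Z. \<rho> j A A)" by (rule sum.swap)
  ultimately show ?thesis by simp
qed

lemma mtrace_disjoint_split:
  assumes "finite Y" "finite X" "Y \<inter> X = {}" "\<And>A. \<rho> A A \<noteq> 0 \<Longrightarrow> A \<subseteq> Y \<union> X"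
  shows "mtrace \<rho> = (\<Sum>A\<in>Pow Y. \<Sum>E\<in>Pow X. \<rho> (A \<union> E) (A \<union> E))"
proof -
  have "mtrace \<rho> = (\<Sum>A\<in>Pow (Y \<union> X). \<rho> A A)"
    unfolding mtrace_def using assms by (intro Sum_any.expand_superset) auto
  also have "\<dots> = (\<Sum>(A, E)\<in>Pow Y \<times> Pow X. \<rho> (A \<union> E) (A \<union> E))"
    by (rule sum.reindex_bij_witness[of _ "\<lambda>(A, E). A \<union> E" "\<lambda>A. (A \<inter> Y, A \<inter> X)"])
      (use assms(3) in \<open>auto simp: Int_Un_distrib[symmetric] Int_absorb2\<close>)
  finally show ?thesis by (simp add: sum.cartesian_product)
qed

lemma sum_swap_pairs:
  "(\<Sum>i\<in>I. \<Sum>j\<in>J. \<Sum>k\<in>K. \<Sum>l\<in>L. f i j k l) = (\<Sum>k\<in>K. \<Sum>l\<in>L. \<Sum>i\<in>I. \<Sum>j\<in>J. f i j k l)"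
proof -
  have "(\<Sum>i\<in>I. \<Sum>j\<in>J. \<Sum>k\<in>K. \<Sum>l\<in>L. f i j k l) = (\<Sum>i\<in>I. \<Sum>k\<in>K. \<Sum>l\<in>L. \<Sum>j\<in>J. f i j k l)"
    by (intro sum.cong refl) (subst sum.swap, intro sum.cong refl sum.swap)
  also have "\<dots> = (\<Sum>k\<in>K. \<Sum>l\<in>L. \<Sum>i\<in>I. \<Sum>j\<in>J. f i j k l)"
    by (subst sum.swap) (intro sum.cong refl sum.swap)
  finally show ?thesis .
qed

text \<open>For fixed input labels \<open>C\<close> and \<open>D\<close>, the trace sums over the
  output label \<open>E\<close> inside \<open>X\<close>. Together with the sum over outcomes this is
  the completeness relation, which leaves only the terms with \<open>D = C\<close>.\<close>

lemma sum_mtrace_kraus_apply: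
  assumes "finite X" "kraus_complete X Ks" "finitary R \<rho>"
  shows "(\<Sum>j<length Ks. mtrace (kraus_apply X (Ks ! j) \<rho>)) = mtrace \<rho>"
proof -
  obtain Z where Z: "finite Z" "\<And>A B. \<rho> A B \<noteq> 0 \<Longrightarrow> A \<subseteq> Z \<and> B \<subseteq> Z"
    using assms(3) unfolding finitary_def by blast
  \<comment> \<open>The qubits of \<open>Y\<close> are spectators. An operator may populate all of
    \<open>X\<close>, so the carrier grows to \<open>Z \<union> X\<close>, which is the disjoint
    union of \<open>Y\<close> and \<open>X\<close>.\<close>
  define Y where "Y = Z - X"
  have Y: "finite Y" "Y \<inter> X = {}" "Z \<union> X = Y \<union> X" "Z \<subseteq> Y \<union> X" using Z(1) by (auto simp: Y_def)
  let ?J = "{..<length Ks}"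
  have complete: "(\<Sum>j\<in>?J. \<Sum>E\<in>Pow X. cnj ((Ks ! j) E D) * (Ks ! j) E C) = (if D = C then 1 else 0)"
    if "C \<in> Pow X" "D \<in> Pow X" for C D
    using assms(2) that by (simp add: kraus_complete_def sum_list_sum_nth atLeast0LessThan)
  have "mtrace (kraus_apply X K \<rho>) = (\<Sum>A\<in>Pow Y. \<Sum>E\<in>Pow X. \<Sum>C\<in>Pow X. \<Sum>D\<in>Pow X.
      \<rho> (A \<union> C) (A \<union> D) * (cnj (K E D) * K E C))" for K
  proof -
    have "mtrace (kraus_apply X K \<rho>) =
        (\<Sum>A\<in>Pow Y. \<Sum>E\<in>Pow X. kraus_apply X K \<rho> (A \<union> E) (A \<union> E))"
    proof (rule mtrace_disjoint_split[OF Y(1) assms(1) Y(2)])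
      show "A \<subseteq> Y \<union> X" if "kraus_apply X K \<rho> A A \<noteq> 0" for A
        using kraus_apply_support[OF Z(2) that] Y(3) by simp
    qed
    moreover have "kraus_apply X K \<rho> (A \<union> E) (A \<union> E) = (\<Sum>C\<in>Pow X. \<Sum>D\<in>Pow X.
        \<rho> (A \<union> C) (A \<union> D) * (cnj (K E D) * K E C))" if "A \<in> Pow Y" "E \<in> Pow X" for A E
    proof -
      have "(A \<union> E) \<inter> X = E" "(A \<union> E) - X = A" using that Y(2) by auto
      then show ?thesis by (simp add: kraus_apply_def mult_ac)
    qed
    ultimately show ?thesis by simp
  qed
  then have "(\<Sum>j\<in>?J. mtrace (kraus_apply X (Ks ! j) \<rho>)) =
      (\<Sum>j\<in>?J. \<Sum>A\<in>Pow Y. \<Sum>E\<in>Pow X. \<Sum>C\<in>Pow X. \<Sum>D\<in>Pow X.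
        \<rho> (A \<union> C) (A \<union> D) * (cnj ((Ks ! j) E D) * (Ks ! j) E C))" by simp
  also have "\<dots> = (\<Sum>A\<in>Pow Y. \<Sum>j\<in>?J. \<Sum>E\<in>Pow X. \<Sum>C\<in>Pow X. \<Sum>D\<in>Pow X.
        \<rho> (A \<union> C) (A \<union> D) * (cnj ((Ks ! j) E D) * (Ks ! j) E C))"
    by (rule sum.swap)
  also have "\<dots> = (\<Sum>A\<in>Pow Y. \<Sum>C\<in>Pow X. \<Sum>D\<in>Pow X. \<rho> (A \<union> C) (A \<union> D) *
        (\<Sum>j\<in>?J. \<Sum>E\<in>Pow X. cnj ((Ks ! j) E D) * (Ks ! j) E C))"
    by (subst sum_swap_pairs) (simp only: sum_distrib_left)
  also have "\<dots> = (\<Sum>A\<in>Pow Y. \<Sum>C\<in>Pow X. \<Sum>D\<in>Pow X. if D = C then \<rho> (A \<union> C) (A \<union> D) else 0)"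
    by (intro sum.cong refl) (simp add: complete)
  also have "\<dots> = (\<Sum>A\<in>Pow Y. \<Sum>C\<in>Pow X. \<rho> (A \<union> C) (A \<union> C))"
    using assms(1) by (simp add: sum.delta')
  also have "\<dots> = mtrace \<rho>"
    using Z(2) Y assms(1) by (intro mtrace_disjoint_split[symmetric]) blast+
  finally show ?thesis .
qed

lemma sum_mtrace_branch:
  assumes "valid_protocol G D \<omega> P" "finitary (early (length \<omega>)) \<rho>"
  shows "(\<Sum>r\<in>deliveries P. mtrace (branch P \<rho> r)) = mtrace \<rho>"
  using assms
proof (induction P arbitrary: \<rho>)
  case (Local v X Ks "next")
  then have X: "X \<subseteq> early (length \<omega>)" "finite X" using register_early[of G \<omega> v] by auto
  let ?J = "{..<length Ks}"
  let ?\<rho> = "\<lambda>j. kraus_apply X (Ks ! j) \<rho>"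
  let ?R = "\<Union>j\<in>?J. deliveries (next j)"
  have fin: "finitary (early (length \<omega>)) (?\<rho> j)" for j
    using X Local.prems by (intro finitary_kraus_apply)
  have valid: "valid_protocol G D \<omega> (next j)" if "j \<in> ?J" for j using that Local.prems by auto
  have "(\<Sum>r\<in>deliveries (Local v X Ks next). mtrace (branch (Local v X Ks next) \<rho> r)) =
      (\<Sum>r\<in>?R. \<Sum>j\<in>?J. mtrace (branch (next j) (?\<rho> j) r))"
    using finitary_branch[OF valid fin]
    by (auto intro!: sum.cong mtrace_sum[where R = "early (length \<omega>)"])
  also have "\<dots> = (\<Sum>j\<in>?J. \<Sum>r\<in>?R. mtrace (branch (next j) (?\<rho> j) r))" by (rule sum.swap)
  \<comment> \<open>Different outcomes may lead to the same record, so the sets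
    \<open>deliveries (next j)\<close> can overlap. No double counting occurs: a subprotocol has
    zero branch at the records of \<open>?R\<close> that it cannot deliver.\<close>
  also have "\<dots> = (\<Sum>j\<in>?J. \<Sum>r\<in>deliveries (next j). mtrace (branch (next j) (?\<rho> j) r))"
    by (intro sum.cong refl sum.mono_neutral_right)
      (auto simp: branch_not_delivered mtrace_def finite_deliveries)
  also have "\<dots> = (\<Sum>j\<in>?J. mtrace (?\<rho> j))"
    using valid fin by (intro sum.cong refl Local.IH) auto
  also have "\<dots> = mtrace \<rho>" using sum_mtrace_kraus_apply[OF X(2)] Local.prems by auto
  finally show ?case .
qed simp


section \<open>The supplied state\<close>

text \<open>Polarization with the coefficient pairs \<open>(1, 1)\<close> and \<open>(1, \<i>)\<close>.\<close>

lemma density_matrix_hermitian: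
  assumes "density_matrix Q \<rho>" "finite Q" "A \<subseteq> Q" "B \<subseteq> Q"
  shows "cnj (\<rho> A B) = \<rho> B A"
proof -
  have form: "Im (\<Sum>S\<in>{A, B}. \<Sum>T\<in>{A, B}. cnj (x S) * \<rho> S T * x T) = 0"
    if "A \<subseteq> Q" "B \<subseteq> Q" for x A B
  proof -
    \<comment> \<open>A test vector vanishing off \<open>A\<close> and \<open>B\<close> isolates the
      block with these labels; the choice \<open>A = B\<close> later reads off a diagonal
      entry.\<close>
    let ?y = "\<lambda>S. if S \<in> {A, B} then x S else 0"
    have "(\<Sum>S\<in>Pow Q. \<Sum>T\<in>Pow Q. cnj (?y S) * \<rho> S T * ?y T) =
        (\<Sum>S\<in>{A, B}. \<Sum>T\<in>{A, B}. cnj (?y S) * \<rho> S T * ?y T)"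
      using that assms(2)
      by (intro sum.mono_neutral_cong_right ballI) (auto intro!: sum.mono_neutral_right)
    also have "\<dots> = (\<Sum>S\<in>{A, B}. \<Sum>T\<in>{A, B}. cnj (x S) * \<rho> S T * x T)"
      by (intro sum.cong refl) auto
    finally have sums: "(\<Sum>S\<in>Pow Q. \<Sum>T\<in>Pow Q. cnj (?y S) * \<rho> S T * ?y T) =
        (\<Sum>S\<in>{A, B}. \<Sum>T\<in>{A, B}. cnj (x S) * \<rho> S T * x T)" .
    have "Im (\<Sum>S\<in>Pow Q. \<Sum>T\<in>Pow Q. cnj (y S) * \<rho> S T * y T) = 0" for y
      using assms(1) unfolding density_matrix_def Let_def by blast
    from this[of ?y] show ?thesis by (simp only: sums)
  qed
  have real: "Im (\<rho> S S) = 0" if "S \<subseteq> Q" for S using form[OF that that, of "\<lambda>_. 1"] by simp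
  show ?thesis
  proof (cases "A = B")
    case True
    then show ?thesis using real[OF assms(3)] by (simp add: complex_eq_iff)
  next
    case False
    then show ?thesis
      using form[OF assms(3,4), of "\<lambda>_. 1"] real[OF assms(3)] real[OF assms(4)]
        form[OF assms(3,4), of "\<lambda>S. if S = A then 1 else \<i>"]
      by (simp add: complex_eq_iff)
  qed
qed

section \<open>Factorisation of the supplied state across a slot boundary\<close>

lemma supplied_append:
  "supplied G (\<omega> @ \<omega>') = supplied G \<omega> \<union> delay_qubit (length \<omega>) ` supplied G \<omega>'"
proof (intro Set.set_eqI iffI)
  fix q assume "q \<in> supplied G (\<omega> @ \<omega>')"
  then obtain w e v where q: "q = Half w e v" "w < length \<omega> + length \<omega>'"
    "e \<in> (\<omega> @ \<omega>') ! w" "v \<in> ends G e"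
    by (auto simp: supplied_def)
  show "q \<in> supplied G \<omega> \<union> delay_qubit (length \<omega>) ` supplied G \<omega>'"
  proof (cases "w < length \<omega>")
    case True
    then show ?thesis using q by (auto simp: supplied_def nth_append)
  next
    case False
    then have "q = delay_qubit (length \<omega>) (Half (w - length \<omega>) e v)" using q by simp
    moreover have "Half (w - length \<omega>) e v \<in> supplied G \<omega>'"
      using q False by (auto simp: supplied_def nth_append)
    ultimately show ?thesis by blast
  qed
qed (auto simp: supplied_def nth_append)

lemma supplied_early: "supplied G \<omega> \<subseteq> early (length \<omega>)"
  by (auto simp: supplied_def early_def)

lemma prod_lessThan_add:
  "(\<Prod>i<m + n. f i) = (\<Prod>i<m. f i) * (\<Prod>i<n. f (m + i :: nat) :: 'a :: comm_monoid_mult)"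
  by (induction n) (simp_all add: mult.assoc)

text \<open>The product over slots splits at \<open>length \<omega>\<close>. The support condition
  has to split too, which is the content of \<open>sub\<close>: off the support, one of the two
  factors is then 0 as well.\<close>

lemma supplied_state_append:
  fixes G :: "('v, 'e) network"
  shows "supplied_state G (\<omega> @ \<omega>') = joint (length \<omega>) (supplied_state G \<omega>) (supplied_state G \<omega>')"
proof (intro ext)
  fix A B
  let ?k = "length \<omega>"
  have sub: "A \<subseteq> supplied G (\<omega> @ \<omega>') \<longleftrightarrow>
      A \<inter> early ?k \<subseteq> supplied G \<omega> \<and> delay_qubit ?k -` A \<subseteq> supplied G \<omega>'" for A
  proof -
    have "A \<subseteq> S \<union> delay_qubit ?k ` T \<longleftrightarrow> A \<inter> early ?k \<subseteq> S \<and> delay_qubit ?k -` A \<subseteq> T"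
      if "S \<subseteq> early ?k" for S T :: "('v, 'e) qubit set"
    proof
      assume A: "A \<subseteq> S \<union> delay_qubit ?k ` T"
      have "q \<in> T" if q: "delay_qubit ?k q \<in> A" for q
      proof -
        have "delay_qubit ?k q \<notin> S" using \<open>S \<subseteq> early ?k\<close> delay_qubit_not_early by blast
        then show ?thesis using A q by auto
      qed
      moreover have "A \<inter> early ?k \<subseteq> S" using A delay_qubit_not_early by blast
      ultimately show "A \<inter> early ?k \<subseteq> S \<and> delay_qubit ?k -` A \<subseteq> T" by blast
    next
      assume "A \<inter> early ?k \<subseteq> S \<and> delay_qubit ?k -` A \<subseteq> T"
      then show "A \<subseteq> S \<union> delay_qubit ?k ` T"
        by (subst early_late_split[of A ?k, symmetric]) (intro Un_mono image_mono; simp)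
    qed
    then show ?thesis by (simp add: supplied_append supplied_early)
  qed
  let ?pair = "\<lambda>e A B w. pair_state G e {v. Half w e v \<in> A} {v. Half w e v \<in> B}"
  show "supplied_state G (\<omega> @ \<omega>') A B =
      joint ?k (supplied_state G \<omega>) (supplied_state G \<omega>') A B"
  proof (cases "A \<subseteq> supplied G (\<omega> @ \<omega>') \<and> B \<subseteq> supplied G (\<omega> @ \<omega>')")
    case True
    have "supplied_state G (\<omega> @ \<omega>') A B = (\<Prod>w<?k. \<Prod>e\<in>\<omega> ! w. ?pair e A B w) *
        (\<Prod>w<length \<omega>'. \<Prod>e\<in>\<omega>' ! w. ?pair e A B (?k + w))"
      using True by (simp add: supplied_state_def prod_lessThan_add nth_append)
    also have "(\<Prod>w<?k. \<Prod>e\<in>\<omega> ! w. ?pair e A B w) =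
        (\<Prod>w<?k. \<Prod>e\<in>\<omega> ! w. ?pair e (A \<inter> early ?k) (B \<inter> early ?k) w)"
      by (intro prod.cong refl) (simp add: early_def)
    also have "\<dots> = supplied_state G \<omega> (A \<inter> early ?k) (B \<inter> early ?k)"
      using True unfolding sub supplied_state_def by simp
    also have "(\<Prod>w<length \<omega>'. \<Prod>e\<in>\<omega>' ! w. ?pair e A B (?k + w)) =
        supplied_state G \<omega>' (delay_qubit ?k -` A) (delay_qubit ?k -` B)"
      using True unfolding sub supplied_state_def by simp
    finally show ?thesis by (simp add: joint_def)
  next
    case False
    then show ?thesis unfolding joint_def supplied_state_def sub by auto
  qed
qed

section \<open>Finite support, Hermitian symmetry and trace of the supplied state\<close>

lemma finite_ends: "resource_network G \<Longrightarrow> e \<in> edges G \<Longrightarrow> finite (ends G e)"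
  by (rule card_ge_0_finite) (simp add: resource_network_def)

lemma finite_supplied:
  assumes "resource_network G" "set \<omega> \<subseteq> Pow (edges G)"
  shows "finite (supplied G \<omega>)"
proof -
  have "q \<in> (\<lambda>(w, e, v). Half w e v) ` ({..<length \<omega>} \<times> (SIGMA e:edges G. ends G e))"
    if q: "q \<in> supplied G \<omega>" for q
  proof -
    obtain w e v where *: "q = Half w e v" "w < length \<omega>" "e \<in> \<omega> ! w" "v \<in> ends G e"
      using q by (auto simp: supplied_def)
    moreover have "e \<in> edges G" using *(2,3) assms(2) by (meson PowD nth_mem subsetD)
    ultimately show ?thesis by (intro image_eqI[of _ _ "(w, e, v)"]) auto
  qed
  then have "supplied G \<omega> \<subseteq> (\<lambda>(w, e, v). Half w e v) ` ({..<length \<omega>} \<times> (SIGMA e:edges G. ends G e))"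
    by blast
  moreover have "finite ({..<length \<omega>} \<times> (SIGMA e:edges G. ends G e))"
    using assms(1) finite_ends[OF assms(1)]
    by (intro finite_cartesian_product finite_SigmaI) (auto simp: resource_network_def)
  ultimately show ?thesis by (meson finite_imageI finite_subset)
qed

lemma finitary_supplied_state:
  assumes "resource_network G" "set \<omega> \<subseteq> Pow (edges G)"
  shows "finitary (early (length \<omega>)) (supplied_state G \<omega>)"
  unfolding finitary_def using finite_supplied[OF assms] supplied_early
  by (intro exI[of _ "supplied G \<omega>"]) (auto simp: supplied_state_def)

lemma hermitian_supplied_state:
  assumes "resource_network G" "set \<omega> \<subseteq> Pow (edges G)"
  shows "hermitian (supplied_state G \<omega>)"
  unfolding hermitian_def
proof (intro allI)
  fix A B
  have "cnj (pair_state G e {v. Half w e v \<in> A} {v. Half w e v \<in> B}) =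
      pair_state G e {v. Half w e v \<in> B} {v. Half w e v \<in> A}"
    if "A \<subseteq> supplied G \<omega>" "B \<subseteq> supplied G \<omega>" "w < length \<omega>" "e \<in> \<omega> ! w" for w e
  proof (rule density_matrix_hermitian)
    have e: "e \<in> edges G" using assms(2) that(3,4) by (meson PowD nth_mem subsetD)
    then show "density_matrix (ends G e) (pair_state G e)"
      using assms(1) by (simp add: resource_network_def)
    show "finite (ends G e)" using finite_ends[OF assms(1) e] .
  qed (use that in \<open>auto simp: supplied_def\<close>)
  then show "cnj (supplied_state G \<omega> A B) = supplied_state G \<omega> B A"
    by (simp add: supplied_state_def cnj_prod)
qed

text \<open>A set of supplied qubits amounts to an independent choice of a set of endpoints for each
  supplied pair. Distributivity therefore turns the trace into the product of the traces of the
  elementary pairs, each equal to 1.\<close>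

lemma mtrace_supplied_state:
  assumes "resource_network G" "set \<omega> \<subseteq> Pow (edges G)"
  shows "mtrace (supplied_state G \<omega>) = 1"
proof -
  let ?I = "SIGMA w:{..<length \<omega>}. \<omega> ! w"
  let ?ends = "\<lambda>(w :: nat, e). Pow (ends G e)"
  let ?\<rho> = "\<lambda>(w :: nat, e) B. pair_state G e B B"
  have edge: "e \<in> edges G" if "w < length \<omega>" "e \<in> \<omega> ! w" for w e
    using assms(2) that by (meson PowD nth_mem subsetD)
  have fin: "finite (\<omega> ! w)" if "w < length \<omega>" for w
    using assms edge[OF that] unfolding resource_network_def by (meson finite_subset subsetI)
  have "mtrace (supplied_state G \<omega>) = (\<Sum>A\<in>Pow (supplied G \<omega>). supplied_state G \<omega> A A)"
    unfolding mtrace_def using finite_supplied[OF assms]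
    by (intro Sum_any.expand_superset) (auto simp: supplied_state_def)
  also have "\<dots> = (\<Sum>A\<in>Pow (supplied G \<omega>). \<Prod>(w, e)\<in>?I. ?\<rho> (w, e) {v. Half w e v \<in> A})"
    using fin by (intro sum.cong refl) (simp add: supplied_state_def prod.Sigma)
  also have "\<dots> = (\<Sum>g\<in>PiE ?I ?ends. \<Prod>i\<in>?I. ?\<rho> i (g i))"
  \<comment> \<open>\<open>g\<close> maps each supplied pair to the endpoints whose qubit is 1. The
    restricted abstraction supplies the default value off \<open>?I\<close> that membership in
    \<open>PiE\<close> requires.\<close>
  proof (rule sum.reindex_bij_witness
      [where j = "\<lambda>A. \<lambda>i\<in>?I. {v. Half (fst i) (snd i) v \<in> A}"
        and i = "\<lambda>g. {q \<in> supplied G \<omega>. holder q \<in> g (slot q, edge q)}"])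
    fix A assume "A \<in> Pow (supplied G \<omega>)"
    then have A: "A \<subseteq> supplied G \<omega>" by simp
    show "{q \<in> supplied G \<omega>. holder q \<in> (\<lambda>i\<in>?I. {v. Half (fst i) (snd i) v \<in> A}) (slot q, edge q)} = A"
      using A by (auto simp: supplied_def)
    show "(\<lambda>i\<in>?I. {v. Half (fst i) (snd i) v \<in> A}) \<in> PiE ?I ?ends"
      using A by (auto simp: supplied_def)
    show "(\<Prod>i\<in>?I. ?\<rho> i ((\<lambda>i\<in>?I. {v. Half (fst i) (snd i) v \<in> A}) i)) =
        (\<Prod>(w, e)\<in>?I. ?\<rho> (w, e) {v. Half w e v \<in> A})"
      by (intro prod.cong) auto
  next
    fix g assume g: "g \<in> PiE ?I ?ends"
    show "{q \<in> supplied G \<omega>. holder q \<in> g (slot q, edge q)} \<in> Pow (supplied G \<omega>)" by auto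
    show "(\<lambda>i\<in>?I. {v. Half (fst i) (snd i) v \<in> {q \<in> supplied G \<omega>. holder q \<in> g (slot q, edge q)}}) = g"
    proof
      fix i
      show "(\<lambda>i\<in>?I. {v. Half (fst i) (snd i) v \<in> {q \<in> supplied G \<omega>. holder q \<in> g (slot q, edge q)}}) i = g i"
      proof (cases "i \<in> ?I")
        case True
        then have "g i \<subseteq> ends G (snd i)" using PiE_mem[OF g True] by (auto simp: case_prod_unfold)
        then show ?thesis using True by (auto simp: supplied_def)
      next
        case False
        then show ?thesis using PiE_arb[OF g False] by simp
      qed
    qed
  qed
  also have "\<dots> = (\<Prod>i\<in>?I. \<Sum>B\<in>?ends i. ?\<rho> i B)"
    using fin edge finite_ends[OF assms(1)] by (intro prod_sum_PiE[symmetric]) auto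
  also have "\<dots> = 1"
    using edge assms(1) by (intro prod.neutral) (auto simp: resource_network_def density_matrix_def)
  finally show ?thesis .
qed


section \<open>Additivity of the expected reward\<close>

text \<open>Ensures that \<open>pmf_of_set (pairings U)\<close> really is uniform on the pairings.
  The induction splits off two users \<open>u\<close> and \<open>v\<close>; the one ordered pair
  \<open>(u, v)\<close> covers exactly these, so the session of each user stays unique.\<close>

lemma pairings_nonempty: "finite U \<Longrightarrow> even (card U) \<Longrightarrow> pairings U \<noteq> {}"
proof (induction "card U" arbitrary: U rule: less_induct)
  case less
  show ?case
  proof (cases "U = {}")
    case True
    then show ?thesis by (auto simp: pairings_def)
  next
    case False
    then have "2 \<le> card U"
      using less.prems by (metis One_nat_def Suc_leI card_gt_0_iff dvd_imp_le)
    then obtain u v V where U: "U = insert u (insert v V)" "u \<noteq> v" "u \<notin> V" "v \<notin> V"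
      using less.prems(1) by (auto simp: card_le_Suc_iff numeral_2_eq_2)
    then have fV: "finite V" using less.prems(1) by simp
    then have "card U = Suc (Suc (card V))" using U by simp
    then obtain D where D: "D \<in> pairings V"
      using less.hyps[of V] less.prems fV by auto
    then have sub: "D \<subseteq> V \<times> V" by (auto simp: pairings_def)
    have "insert (u, v) D \<in> pairings U"
      unfolding pairings_def mem_Collect_eq
    proof (intro conjI ballI)
      show "insert (u, v) D \<subseteq> U \<times> U" using sub U by auto
      show "case p of (s, t) \<Rightarrow> s \<noteq> t" if "p \<in> insert (u, v) D" for p
        using that D U by (auto simp: pairings_def)
      fix w assume w: "w \<in> U"
      show "\<exists>!i. i \<in> insert (u, v) D \<and> (w = fst i \<or> w = snd i)"
      proof (cases "w \<in> V")
        case True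
        then have "\<exists>!i. i \<in> D \<and> (w = fst i \<or> w = snd i)" using D by (auto simp: pairings_def)
        moreover have "w \<noteq> u" "w \<noteq> v" using True U by auto
        ultimately show ?thesis by (metis fst_conv snd_conv insert_iff)
      next
        case False
        then have "w \<noteq> fst i \<and> w \<noteq> snd i" if "i \<in> D" for i using sub that by force
        moreover have "w = u \<or> w = v" using w U False by auto
        ultimately show ?thesis by (intro ex1I[of _ "(u, v)"]) auto
      qed
    qed
    then show ?thesis by auto
  qed
qed

text \<open>Parity and size of \<open>M\<close> make both uniform choices range over nonempty finite
  sets, so that their supports are these sets. Finiteness serves to make all rewards
  integrable.\<close>

lemma finite_set_demand_law:
  assumes "finite (nodes G)" "even M" "M \<le> card (nodes G)"
  shows "finite (set_pmf (demand_law G M))"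
proof -
  let ?\<U> = "{U. U \<subseteq> nodes G \<and> card U = M}"
  have ne: "?\<U> \<noteq> {}" using obtain_subset_with_card_n[OF assms(3)] by blast
  have fin: "finite ?\<U>" using assms(1) by simp
  have "finite (set_pmf (pmf_of_set (pairings U)))" if "U \<in> ?\<U>" for U
  proof -
    have "finite U" using that assms(1) by (auto intro: finite_subset)
    moreover from this have "finite (pairings U)"
      by (intro finite_subset[of "pairings U" "Pow (U \<times> U)"]) (auto simp: pairings_def)
    ultimately show ?thesis
      using that assms(2) pairings_nonempty[of U] by (subst set_pmf_of_set) auto
  qed
  then show ?thesis
    unfolding demand_law_def set_bind_pmf set_pmf_of_set[OF ne fin] using fin by auto
qed

section \<open>Probabilities and conditional states of delivery records\<close>

lemma finitary_divide:
  assumes "finitary R \<rho>"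
  shows "finitary R (\<lambda>A B. \<rho> A B / c)"
proof -
  obtain Z where "finite Z" "Z \<subseteq> R" and Z: "\<And>A B. \<rho> A B \<noteq> 0 \<Longrightarrow> A \<subseteq> Z \<and> B \<subseteq> Z"
    using assms unfolding finitary_def by blast
  moreover have "A \<subseteq> Z \<and> B \<subseteq> Z" if "\<rho> A B / c \<noteq> 0" for A B
    using that by (intro Z) simp
  ultimately show ?thesis unfolding finitary_def by metis
qed

lemma mtrace_divide:
  assumes "finitary R \<rho>"
  shows "mtrace (\<lambda>A B. \<rho> A B / c) = mtrace \<rho> / c"
proof -
  obtain Z where "finite Z" "\<And>A B. \<rho> A B \<noteq> 0 \<Longrightarrow> A \<subseteq> Z \<and> B \<subseteq> Z"
    using assms unfolding finitary_def by blast
  then have "{A. \<rho> A A \<noteq> 0} \<subseteq> Pow Z" "finite (Pow Z)" by blast+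
  then have "finite {A. \<rho> A A \<noteq> 0}" by (rule finite_subset)
  then show ?thesis
    unfolding mtrace_def divide_inverse by (rule Sum_any_left_distrib[symmetric])
qed

text \<open>Isolated because additivity already holds for each demand and link record separately,
  before any averaging.\<close>

definition window_reward ::
    "('v, 'e) network \<Rightarrow> real \<Rightarrow> ('v, 'e) strategy \<Rightarrow> 'v demand \<Rightarrow> 'e set list \<Rightarrow> real" where
  "window_reward G F S D \<omega> = (\<Sum>r\<in>deliveries (S D \<omega>). delivery_prob G S D \<omega> r *
     (\<Sum>(s, t)\<in>D. distance G s t * real (output_count G F S D \<omega> r (s, t))))"

lemma mtrace_branch_supplied_state:
  assumes "resource_network G" "set \<omega> \<subseteq> Pow (edges G)"
  shows "mtrace (branch (S D \<omega>) (supplied_state G \<omega>) r) = of_real (delivery_prob G S D \<omega> r)"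
  unfolding delivery_prob_def
  by (intro mtrace_hermitian hermitian_branch hermitian_supplied_state assms)

lemma sum_delivery_prob:
  assumes "resource_network G" "set \<omega> \<subseteq> Pow (edges G)" "valid_protocol G D \<omega> (S D \<omega>)"
  shows "(\<Sum>r\<in>deliveries (S D \<omega>). delivery_prob G S D \<omega> r) = 1"
proof -
  have "(\<Sum>r\<in>deliveries (S D \<omega>). mtrace (branch (S D \<omega>) (supplied_state G \<omega>) r)) = 1"
    using sum_mtrace_branch[OF assms(3) finitary_supplied_state[OF assms(1,2)]]
      mtrace_supplied_state[OF assms(1,2)] by simp
  from arg_cong[OF this, of Re] show ?thesis by (simp add: delivery_prob_def)
qed

lemma finitary_conditional_state:
  assumes "resource_network G" "set \<omega> \<subseteq> Pow (edges G)" "valid_protocol G D \<omega> (S D \<omega>)"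
  shows "finitary (early (length \<omega>)) (conditional_state G S D \<omega> r)"
proof -
  have "conditional_state G S D \<omega> r = (\<lambda>A B. branch (S D \<omega>) (supplied_state G \<omega>) r A B /
      of_real (delivery_prob G S D \<omega> r))" by (intro ext) (rule conditional_state_def)
  then show ?thesis
    by (simp only:) (intro finitary_divide finitary_branch[OF assms(3)] finitary_supplied_state assms(1,2))
qed

lemma mtrace_conditional_state:
  assumes "resource_network G" "set \<omega> \<subseteq> Pow (edges G)" "valid_protocol G D \<omega> (S D \<omega>)"
    and "delivery_prob G S D \<omega> r \<noteq> 0"
  shows "mtrace (conditional_state G S D \<omega> r) = 1"
proof -
  have "conditional_state G S D \<omega> r = (\<lambda>A B. branch (S D \<omega>) (supplied_state G \<omega>) r A B /
      of_real (delivery_prob G S D \<omega> r))" by (intro ext) (rule conditional_state_def)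
  then show ?thesis
    using assms(4) mtrace_branch_supplied_state[OF assms(1,2)]
    by (simp add: mtrace_divide[OF finitary_branch[OF assms(3) finitary_supplied_state[OF assms(1,2)]]])
qed

lemma sum_product_add:
  fixes p q a b :: "'a \<Rightarrow> 'b :: comm_semiring_0"
  shows "(\<Sum>(x, y)\<in>A \<times> B. p x * q y * (a x + b y)) =
    (\<Sum>x\<in>A. p x * a x) * (\<Sum>y\<in>B. q y) + (\<Sum>x\<in>A. p x) * (\<Sum>y\<in>B. q y * b y)"
  unfolding sum_product sum.cartesian_product sum.distrib[symmetric]
  by (intro sum.cong refl) (auto simp: algebra_simps)

lemma window_reward_concatenation:
  assumes G: "resource_network G"
    and \<omega>: "set \<omega> \<subseteq> Pow (edges G)" and \<omega>': "set \<omega>' \<subseteq> Pow (edges G)"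
    and S: "valid_protocol G D \<omega> (S D \<omega>)" and T: "valid_protocol G D \<omega>' (T D \<omega>')"
  shows "window_reward G F (concatenation (length \<omega>) S T) D (\<omega> @ \<omega>') =
    window_reward G F S D \<omega> + window_reward G F T D \<omega>'"
proof -
  let ?k = "length \<omega>"
  let ?U = "concatenation ?k S T"
  let ?app = "\<lambda>(r, r'). r @ map (delay_output ?k) r'"
  let ?RS = "deliveries (S D \<omega>)" and ?RT = "deliveries (T D \<omega>')"
  let ?p = "delivery_prob G S D \<omega>" and ?q = "delivery_prob G T D \<omega>'"
  let ?value = "\<lambda>c. \<Sum>(s, t)\<in>D. distance G s t * real (c (s, t))"
  let ?a = "\<lambda>r. ?value (output_count G F S D \<omega> r)"
  let ?b = "\<lambda>r. ?value (output_count G F T D \<omega>' r)"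
  have U: "?U D (\<omega> @ \<omega>') = run_then (S D \<omega>) (delay ?k (T D \<omega>'))"
    by (simp add: concatenation_def)
  have early_r: "early_delivery ?k r" if "r \<in> ?RS" for r
    using valid_protocol_early_delivery[OF S that] .
  have deliveries: "deliveries (?U D (\<omega> @ \<omega>')) = ?app ` (?RS \<times> ?RT)"
    unfolding U deliveries_run_then deliveries_delay by (auto simp: image_iff)
  have inj: "inj_on ?app (?RS \<times> ?RT)"
    using append_delayed_eq_iff[OF early_r early_r] by (auto simp: inj_on_def)
  have fS: "finitary (early ?k) (branch (S D \<omega>) (supplied_state G \<omega>) r)" for r
    by (intro finitary_branch[OF S] finitary_supplied_state G \<omega>)
  have fT: "finitary (early (length \<omega>')) (branch (T D \<omega>') (supplied_state G \<omega>') r)" for r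
    by (intro finitary_branch[OF T] finitary_supplied_state G \<omega>')
  have branch: "branch (?U D (\<omega> @ \<omega>')) (supplied_state G (\<omega> @ \<omega>')) (?app (r, r')) =
      joint ?k (branch (S D \<omega>) (supplied_state G \<omega>) r) (branch (T D \<omega>') (supplied_state G \<omega>') r')"
    if "r \<in> ?RS" for r r'
    using branch_run_then_delayed[OF S early_r[OF that]]
    by (simp add: U supplied_state_append)
  have prob: "delivery_prob G ?U D (\<omega> @ \<omega>') (?app (r, r')) = ?p r * ?q r'" if "r \<in> ?RS" for r r'
    unfolding delivery_prob_def[of G ?U] branch[OF that] mtrace_joint[OF fS fT]
      mtrace_branch_supplied_state[where S = S, OF G \<omega>]
      mtrace_branch_supplied_state[where S = T, OF G \<omega>'] by simp
  have state: "conditional_state G ?U D (\<omega> @ \<omega>') (?app (r, r')) =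
      joint ?k (conditional_state G S D \<omega> r) (conditional_state G T D \<omega>' r')" if "r \<in> ?RS" for r r'
    by (intro ext) (simp only: conditional_state_def prob[OF that] branch[OF that] joint_def
        times_divide_times_eq of_real_mult)
  \<comment> \<open>If one of the two records has probability 0, then the counts need not add up, since the
    conditional states are then 0 by the convention \<open>x / 0 = 0\<close>; such terms have weight 0.\<close>
  have count: "output_count G F ?U D (\<omega> @ \<omega>') (?app (r, r')) i =
      output_count G F S D \<omega> r i + output_count G F T D \<omega>' r' i"
    if r: "r \<in> ?RS" and nonzero: "?p r \<noteq> 0" "?q r' \<noteq> 0" for r r' i
  proof -
    note fin = finitary_conditional_state[where S = S, OF G \<omega> S]
      finitary_conditional_state[where S = T, OF G \<omega>' T]
    have "bell_fidelity (conditional_state G ?U D (\<omega> @ \<omega>') (?app (r, r'))) (qubit1 x) (qubit2 x) =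
        bell_fidelity (conditional_state G S D \<omega> r) (qubit1 x) (qubit2 x)" if "x \<in> set r" for x
      unfolding state[OF r] using early_r[OF r] that
        mtrace_conditional_state[where S = T, OF G \<omega>' T nonzero(2)]
      by (intro bell_fidelity_joint_early[OF fin]) (simp_all add: early_delivery_def)
    moreover have "bell_fidelity (conditional_state G ?U D (\<omega> @ \<omega>') (?app (r, r')))
          (delay_qubit ?k a) (delay_qubit ?k b) =
        bell_fidelity (conditional_state G T D \<omega>' r') a b" for a b
      unfolding state[OF r]
      by (intro bell_fidelity_joint_late[OF fin] mtrace_conditional_state G \<omega> S nonzero(1))
    ultimately show ?thesis
      by (simp add: output_count_def filter_map o_def cong: filter_cong)
  qed
  have "?value (output_count G F ?U D (\<omega> @ \<omega>') (?app (r, r'))) = ?a r + ?b r'"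
    if "r \<in> ?RS" "?p r \<noteq> 0" "?q r' \<noteq> 0" for r r'
    using count[OF that]
    by (simp add: case_prod_unfold sum.distrib[symmetric] distrib_left)
  then have "delivery_prob G ?U D (\<omega> @ \<omega>') (?app (r, r')) *
      ?value (output_count G F ?U D (\<omega> @ \<omega>') (?app (r, r'))) = ?p r * ?q r' * (?a r + ?b r')"
    if "r \<in> ?RS" for r r'
    using prob[OF that, of r'] that by (cases "?p r = 0 \<or> ?q r' = 0") auto
  then have "window_reward G F ?U D (\<omega> @ \<omega>') =
      (\<Sum>(r, r')\<in>?RS \<times> ?RT. ?p r * ?q r' * (?a r + ?b r'))"
    unfolding window_reward_def deliveries sum.reindex[OF inj] o_def
    by (intro sum.cong refl) auto
  \<comment> \<open>Each value depends on one record only. Summing out the other record leaves a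
    total probability as coefficient, and both totals are 1.\<close>
  also have "\<dots> = (\<Sum>r\<in>?RS. ?p r * ?a r) * (\<Sum>r'\<in>?RT. ?q r') + (\<Sum>r\<in>?RS. ?p r) * (\<Sum>r'\<in>?RT. ?q r' * ?b r')"
    by (rule sum_product_add)
  also have "\<dots> = window_reward G F S D \<omega> + window_reward G F T D \<omega>'"
    by (simp add: window_reward_def sum_delivery_prob G \<omega> \<omega>' S T)
  finally show ?thesis .
qed

text \<open>Here the independence and identical distribution of slots enter: the two parts of a link
  record are independent, and the late part has the law of a fresh window.\<close>

lemma links_law_add:
  "links_law G (k + l) = map_pmf (\<lambda>(\<omega>, \<omega>'). \<omega> @ \<omega>') (pair_pmf (links_law G k) (links_law G l))"
  by (simp add: links_law_def replicate_pmf_distrib pair_pmf_def map_bind_pmf)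

lemma set_links_law:
  assumes "resource_network G" "\<omega> \<in> set_pmf (links_law G W)"
  shows "set \<omega> \<subseteq> Pow (edges G)" "length \<omega> = W"
  using assms by (auto simp: links_law_def set_replicate_pmf resource_network_def)

lemma finite_set_links_law:
  assumes "resource_network G"
  shows "finite (set_pmf (links_law G W))"
proof (rule finite_subset)
  show "set_pmf (links_law G W) \<subseteq> {\<omega>. set \<omega> \<subseteq> Pow (edges G) \<and> length \<omega> = W}"
    using set_links_law[OF assms] by blast
  show "finite {\<omega>. set \<omega> \<subseteq> Pow (edges G) \<and> length \<omega> = W}"
    using assms by (intro finite_lists_length_eq) (simp add: resource_network_def)
qed

lemma expected_reward_concatenation:
  assumes G: "resource_network G" and M: "even M" "M \<le> card (nodes G)"
    and S: "locc_strategy G M k S" and T: "locc_strategy G M l T"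
  shows "expected_reward G M F (k + l) (concatenation k S T) =
    expected_reward G M F k S + expected_reward G M F l T"
proof -
  let ?\<mu> = "pair_pmf (demand_law G M) (pair_pmf (links_law G k) (links_law G l))"
  have expected: "expected_reward G M F W S' =
      measure_pmf.expectation (pair_pmf (demand_law G M) (links_law G W))
        (\<lambda>(D, \<omega>). window_reward G F S' D \<omega>)" for W S'
    by (simp add: expected_reward_def window_reward_def)
  have "finite (set_pmf ?\<mu>)"
    using finite_set_demand_law[of G M] finite_set_links_law[OF G] G M
    by (auto simp: resource_network_def)
  \<comment> \<open>Integrability is what allows the expectation to be split: the Bochner integral
    of a non-integrable function is 0 by convention, so additivity could fail.\<close>
  then have int: "integrable ?\<mu> f" for f :: "_ \<Rightarrow> real" by (rule integrable_measure_pmf_finite)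
  have "expected_reward G M F (k + l) (concatenation k S T) =
      measure_pmf.expectation ?\<mu> (\<lambda>(D, \<omega>, \<omega>'). window_reward G F (concatenation k S T) D (\<omega> @ \<omega>'))"
    unfolding expected links_law_add pair_map_pmf2 integral_map_pmf
    by (simp add: case_prod_unfold apsnd_def map_prod_def)
  also have "\<dots> = measure_pmf.expectation ?\<mu>
      (\<lambda>(D, \<omega>, \<omega>'). window_reward G F S D \<omega> + window_reward G F T D \<omega>')"
  proof (intro integral_cong_AE AE_pmfI)
    fix x assume "x \<in> set_pmf ?\<mu>"
    then obtain D \<omega> \<omega>' where x: "x = (D, \<omega>, \<omega>')" "D \<in> set_pmf (demand_law G M)"
      "\<omega> \<in> set_pmf (links_law G k)" "\<omega>' \<in> set_pmf (links_law G l)" by auto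
    have "window_reward G F (concatenation (length \<omega>) S T) D (\<omega> @ \<omega>') =
        window_reward G F S D \<omega> + window_reward G F T D \<omega>'"
      using x S T by (intro window_reward_concatenation G set_links_law(1)) (auto simp: locc_strategy_def)
    then show "(case x of (D, \<omega>, \<omega>') \<Rightarrow> window_reward G F (concatenation k S T) D (\<omega> @ \<omega>')) =
        (case x of (D, \<omega>, \<omega>') \<Rightarrow> window_reward G F S D \<omega> + window_reward G F T D \<omega>')"
      using x set_links_law(2)[OF G x(3)] by simp
  qed simp_all
  also have "\<dots> = measure_pmf.expectation ?\<mu> (\<lambda>(D, \<omega>, \<omega>'). window_reward G F S D \<omega>) +
      measure_pmf.expectation ?\<mu> (\<lambda>(D, \<omega>, \<omega>'). window_reward G F T D \<omega>')"
    unfolding case_prod_unfold by (intro Bochner_Integration.integral_add int)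
  \<comment> \<open>Both windows share the demand, so their rewards may be correlated, but linearity
    only involves marginals. Each term ignores one link record, which is projected away.\<close>
  also have "measure_pmf.expectation ?\<mu> (\<lambda>(D, \<omega>, \<omega>'). window_reward G F S D \<omega>) =
      expected_reward G M F k S"
    unfolding expected
    by (subst map_fst_pair_pmf[of "links_law G k" "links_law G l", symmetric])
      (simp only: pair_map_pmf2 integral_map_pmf, simp add: case_prod_unfold)
  also have "measure_pmf.expectation ?\<mu> (\<lambda>(D, \<omega>, \<omega>'). window_reward G F T D \<omega>') =
      expected_reward G M F l T"
    unfolding expected
    by (subst map_snd_pair_pmf[of "links_law G k" "links_law G l", symmetric])
      (simp only: pair_map_pmf2 integral_map_pmf, simp add: case_prod_unfold)
  finally show ?thesis .
qed

theorem mainTheorem8: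
  fixes G :: "('v, 'e) network" and N M :: nat and F :: real
    and Adm :: "nat \<Rightarrow> ('v, 'e) strategy set"
  assumes "resource_network G" and "card (nodes G) = N"
    and "even M" and "M \<le> N"
    and "strategy_class G M Adm"
    and "closed_under_concatenation Adm"
  shows "convergent (\<lambda>W. capacity G M F Adm W) \<and>
    lim (\<lambda>W. capacity G M F Adm W) = (SUP W\<in>{1..}. capacity G M F Adm W) \<and>
    (\<forall>W\<ge>1. capacity G M F Adm 1 \<le> capacity G M F Adm W \<and>
      capacity G M F Adm W \<le> lim (\<lambda>W. capacity G M F Adm W))"
proof -
  \<comment> \<open>Total rewards rather than rates: totals add under concatenation, and the
    division by \<open>W\<close> is left to \<open>ereal_capacity_limit\<close>.\<close>
  let ?R = "\<lambda>W. expected_reward G M F W ` Adm W"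
  let ?c = "\<lambda>W. capacity G M F Adm W"
  have nonempty: "?R W \<noteq> {}" if "1 \<le> W" for W
    using assms(5) that by (simp add: strategy_class_def)
  have add: "x + y \<in> ?R (k + l)" if kl: "1 \<le> k" "1 \<le> l" and xy: "x \<in> ?R k" "y \<in> ?R l" for k l x y
  proof -
    obtain S T where ST: "S \<in> Adm k" "T \<in> Adm l"
      and x: "x = expected_reward G M F k S" and y: "y = expected_reward G M F l T"
      using xy by blast
    have "locc_strategy G M k S" "locc_strategy G M l T"
      using assms(5) kl ST by (auto simp: strategy_class_def)
    then have "x + y = expected_reward G M F (k + l) (concatenation k S T)"
      unfolding x y using assms(1-4) by (simp add: expected_reward_concatenation)
    moreover have "concatenation k S T \<in> Adm (k + l)"
      using assms(6) kl ST by (simp add: closed_under_concatenation_def)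
    ultimately show ?thesis by blast
  qed
  have capacity: "?c = (\<lambda>W. SUP x\<in>?R W. ereal (1 / real W * x))"
    by (simp add: capacity_def image_image)
  have limit: "?c \<longlonglongrightarrow> (SUP W\<in>{1..}. ?c W)"
    unfolding capacity by (rule ereal_capacity_limit(1)[where R = ?R, OF nonempty add])
  have first: "?c 1 \<le> ?c W" if "1 \<le> W" for W
    unfolding capacity using ereal_capacity_limit(2)[where R = ?R, OF nonempty add that] by simp
  have "?c W \<le> (SUP W\<in>{1..}. ?c W)" if "1 \<le> W" for W
    using that by (intro SUP_upper) simp
  \<comment> \<open>Convergence is meant in the topology of \<open>ereal\<close>, so it covers an
    infinite limit.\<close>
  then show ?thesis
    using limit first by (auto simp: convergent_def limI)
qed

end
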